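(* Let $f\in L^p(\Omega)$ with $1<p<\frac{2Q}{Q+2}$. Then the solution $u$ found by approximation of $$X^*(A(x)Xu)=f\ \text{ in }\Omega,\qquad u=0\ \text{ on }\partial\Omega$$ belongs to $W^{1,p^*}_0(\Omega,X)$, where $p^*=\frac{pQ}{Q-p}$.
   Context: Setting. $N\ge2$, $\Omega\subset\mathbb R^N$ is open and bounded, and $X=\{X_1,\dots,X_m\}$ is a fixed family of locally Lipschitz vector fields on $\mathbb R^N$, $X_j=\sum_{k=1}^N c_{jk}\partial_{x_k}$; for $u\in C^1$, $Xu=(X_1u,\dots,X_mu)$ is the $X$-gradient. An absolutely continuous path $\gamma:[0,T]\to\mathbb R^N$ is $X$-subunit if $\dot\gamma(t)=\sum_{j}\theta_j(t)X_j(\gamma(t))$ with $\sum_j\theta_j^2(t)\le1$ for a.e. $t$. It is assumed that any two points of $\Omega$ are joined by an $X$-subunit path in $\Omega$; $d_X(x,y)$ is the infimum of all $T>0$ for which there is an $X$-subunit $\gamma:[0,T]\to\mathbb R^N$ with $\gamma(0)=x$, $\gamma(T)=y$; $B_r$ denotes a $d_X$-ball of radius $r$ and $B_{cr}$ the concentric ball of radius $cr$. Standing assumptions: (i) $|y-x|\to0$ implies $d_X(x,y)\to0$; (ii) $(\Omega,d_X,\mathcal L^N)$ is doubling: there is $Q>2$ with $0<\mathcal L^N(B_{2r})\le2^Q\mathcal L^N(B_r)$; (iii) there are $C_P,\nu>0$ such that $\frac1{|B_r|}\int_{B_r}|u-u_r|\,dx\le C_P\,r\,\frac1{|B_{\nu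 r}|}\int_{B_{\nu r}}|Xu|\,dx$ for every $d_X$-ball $B_r$ and $u\in C^1(\overline{B_{\nu r}})$, with $u_r=\frac1{|B_r|}\int_{B_r}u\,dx$. $W^{1,p}_0(\Omega,X)$ is the closure of $C^\infty_c(\Omega)$ under the norm $\|Xu\|_{L^p(\Omega)}$ (with $Xu$ the $L^p$-limit of the $X$-gradients of approximating functions). Known fact (Sobolev inequality): for $1\le p<Q$ there is a constant $\mathcal S_p$ with $\|u\|_{L^{p^*}(\Omega)}\le\mathcal S_p\|Xu\|_{L^p(\Omega)}$ for all $u\in W^{1,p}_0(\Omega,X)$, $p^*=\frac{pQ}{Q-p}$. $A:\Omega\to\mathbb R^{m\times m}$ is measurable with bounded entries (not necessarily symmetric) and there are $0<\alpha<\beta$ with $\alpha|\eta|^2\le A(x)\eta\cdot\eta\le\beta|\eta|^2$ for all $\eta\in\mathbb R^m$. $X^*$ is the formal adjoint: $\langle X^*F,v\rangle=\int_\Omega F\cdot Xv$. Weak solution. For $h\in L^{\frac{2Q}{Q+2}}(\Omega)$, the weak solution of $X^*(AXu)=h$ in $\Omega$, $u=0$ on $\partial\Omega$, is the unique (Lax–Milgram) $u\in W^{1,2}_0(\Omega,X)$ with $\int_\Omega A\,Xu\cdot Xv=\int_\Omega h\,v$ for all $v\in W^{1,2}_0(\Omega,X)$. Solution found by approximation. For $f\in L^1(\Omega)$ let $f_n=\max\{-n,\min\{f,n\}\}$ and let $u_n$ be the weak solution with datum $f_n$. The solution found by approximation is the limit $u$ of (a subsequence of) $(u_n)_n$, weakly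 in $W^{1,q}_0(\Omega,X)$ for every $1<q<\frac Q{Q-1}$ and strongly in $L^s(\Omega)$ for every $1\le s<\frac Q{Q-2}$; it exists and is unique, and does not change if $(f_n)$ is replaced by any other sequence in $L^{\frac{2Q}{Q+2}}(\Omega)$ converging to $f$ in $L^1(\Omega)$. *)

theory Defs
  imports "HOL-Analysis.Analysis"
begin

text \<open>
  A family of vector fields \<open>X\<^sub>j = \<Sum>\<^sub>k c\<^sub>j\<^sub>k \<partial>\<^sub>k\<close> is represented by its
  coefficients \<open>c :: real ^ 'n \<Rightarrow> real ^ 'n ^ 'm\<close>; the vector \<open>X\<^sub>j(x)\<close> is \<open>c x $ j\<close>.
\<close>

type_synonym ('n, 'm) vfields = "real ^ 'n \<Rightarrow> real ^ 'n ^ 'm"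

definition locally_Lipschitz_fields :: "('n::finite, 'm::finite) vfields \<Rightarrow> bool" where
  "locally_Lipschitz_fields c \<longleftrightarrow>
     (\<forall>j x. \<exists>e>0. \<exists>L. L-lipschitz_on (ball x e) (\<lambda>y. c y $ j))"

definition partial_deriv :: "'n::finite \<Rightarrow> (real ^ 'n \<Rightarrow> real) \<Rightarrow> real ^ 'n \<Rightarrow> real" where
  "partial_deriv k u x = frechet_derivative u (at x) (axis k 1)"

definition Xgrad :: "('n::finite, 'm::finite) vfields \<Rightarrow> (real ^ 'n \<Rightarrow> real) \<Rightarrow> real ^ 'n \<Rightarrow> real ^ 'm" where
  "Xgrad c u x = (\<chi> j. \<Sum>k\<in>UNIV. c x $ j $ k * partial_deriv k u x)"

definition abs_continuous_path :: "real \<Rightarrow> (real \<Rightarrow> 'a::real_normed_vector) \<Rightarrow> bool" where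
  "abs_continuous_path T \<gamma> \<longleftrightarrow>
     (\<forall>e>0. \<exists>d>0. \<forall>I :: (real \<times> real) set.
        finite I \<longrightarrow>
        (\<forall>(a, b)\<in>I. 0 \<le> a \<and> a \<le> b \<and> b \<le> T) \<longrightarrow>
        pairwise (\<lambda>(a, b) (a', b'). {a<..<b} \<inter> {a'<..<b'} = {}) I \<longrightarrow>
        (\<Sum>(a, b)\<in>I. b - a) < d \<longrightarrow>
        (\<Sum>(a, b)\<in>I. norm (\<gamma> b - \<gamma> a)) < e)"

definition subunit_path :: "('n::finite, 'm::finite) vfields \<Rightarrow> real \<Rightarrow> (real \<Rightarrow> real ^ 'n) \<Rightarrow> bool" where
  "subunit_path c T \<gamma> \<longleftrightarrow>
     abs_continuous_path T \<gamma> \<and>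
     (\<exists>\<theta> :: real \<Rightarrow> real ^ 'm. AE t in lebesgue_on {0..T}.
        (\<gamma> has_vector_derivative (\<Sum>j\<in>UNIV. (\<theta> t $ j) *\<^sub>R (c (\<gamma> t) $ j))) (at t) \<and>
        (\<Sum>j\<in>UNIV. (\<theta> t $ j)\<^sup>2) \<le> 1)"

definition subunit_connected :: "('n::finite, 'm::finite) vfields \<Rightarrow> (real ^ 'n) set \<Rightarrow> bool" where
  "subunit_connected c \<Omega> \<longleftrightarrow>
     (\<forall>x\<in>\<Omega>. \<forall>y\<in>\<Omega>. \<exists>T>0. \<exists>\<gamma>.
        subunit_path c T \<gamma> \<and> \<gamma> 0 = x \<and> \<gamma> T = y \<and> \<gamma> ` {0..T} \<subseteq> \<Omega>)"

text \<open>Extended-real valued: the distance is \<open>\<infinity>\<close> if no subunit path joins the two points.\<close>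

definition cc_dist :: "('n::finite, 'm::finite) vfields \<Rightarrow> real ^ 'n \<Rightarrow> real ^ 'n \<Rightarrow> ereal" where
  "cc_dist c x y =
     Inf (ereal ` {T. T > 0 \<and> (\<exists>\<gamma>. subunit_path c T \<gamma> \<and> \<gamma> 0 = x \<and> \<gamma> T = y)})"

text \<open>Balls of the metric space \<open>(\<Omega>, d\<^sub>X)\<close>; the paths defining \<open>d\<^sub>X\<close> may leave \<open>\<Omega>\<close>.\<close>

definition cc_ball :: "('n::finite, 'm::finite) vfields \<Rightarrow> (real ^ 'n) set \<Rightarrow> real ^ 'n \<Rightarrow> real \<Rightarrow> (real ^ 'n) set" where
  "cc_ball c \<Omega> x r = {y \<in> \<Omega>. cc_dist c x y < ereal r}"

definition cc_dist_continuous :: "('n::finite, 'm::finite) vfields \<Rightarrow> (real ^ 'n) set \<Rightarrow> bool" where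
  "cc_dist_continuous c \<Omega> \<longleftrightarrow> (\<forall>x\<in>\<Omega>. (cc_dist c x \<longlongrightarrow> 0) (at x))"

definition cc_doubling :: "('n::finite, 'm::finite) vfields \<Rightarrow> (real ^ 'n) set \<Rightarrow> real \<Rightarrow> bool" where
  "cc_doubling c \<Omega> Q \<longleftrightarrow>
     (\<forall>x\<in>\<Omega>. \<forall>r>0.
        0 < emeasure lebesgue (cc_ball c \<Omega> x (2 * r)) \<and>
        emeasure lebesgue (cc_ball c \<Omega> x (2 * r))
          \<le> ennreal (2 powr Q) * emeasure lebesgue (cc_ball c \<Omega> x r))"

text \<open>\<open>u \<in> C\<^sup>1\<close> of the closure of the open set \<open>S\<close>: \<open>u\<close> is \<open>C\<^sup>1\<close> on \<open>S\<close>, and \<open>u\<close> and its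
  gradient extend continuously to the closure.\<close>

definition C1_closure :: "(real ^ 'n::finite) set \<Rightarrow> (real ^ 'n \<Rightarrow> real) \<Rightarrow> bool" where
  "C1_closure S u \<longleftrightarrow>
     continuous_on (closure S) u \<and>
     (\<exists>g :: real ^ 'n \<Rightarrow> real ^ 'n. continuous_on (closure S) g \<and>
        (\<forall>x\<in>S. (u has_derivative (\<lambda>h. g x \<bullet> h)) (at x)))"

definition average :: "(real ^ 'n::finite) set \<Rightarrow> (real ^ 'n \<Rightarrow> real) \<Rightarrow> real" where
  "average S u = (LINT x|lebesgue_on S. u x) / measure lebesgue S"

definition cc_poincare :: "('n::finite, 'm::finite) vfields \<Rightarrow> (real ^ 'n) set \<Rightarrow> bool" where
  "cc_poincare c \<Omega> \<longleftrightarrow>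
     (\<exists>C_P>0. \<exists>\<nu>>0. \<forall>x\<in>\<Omega>. \<forall>r>0. \<forall>u.
        C1_closure (cc_ball c \<Omega> x (\<nu> * r)) u \<longrightarrow>
        average (cc_ball c \<Omega> x r) (\<lambda>y. \<bar>u y - average (cc_ball c \<Omega> x r) u\<bar>)
          \<le> C_P * r * average (cc_ball c \<Omega> x (\<nu> * r)) (\<lambda>y. norm (Xgrad c u y)))"

text \<open>Elements of function spaces are represented by functions, not by classes modulo null sets.\<close>

definition in_Lp :: "(real ^ 'n::finite) set \<Rightarrow> real \<Rightarrow> (real ^ 'n \<Rightarrow> 'b::euclidean_space) \<Rightarrow> bool" where
  "in_Lp \<Omega> p f \<longleftrightarrow>
     f \<in> borel_measurable (lebesgue_on \<Omega>) \<and>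
     integrable (lebesgue_on \<Omega>) (\<lambda>x. norm (f x) powr p)"

definition Lp_norm :: "(real ^ 'n::finite) set \<Rightarrow> real \<Rightarrow> (real ^ 'n \<Rightarrow> 'b::euclidean_space) \<Rightarrow> real" where
  "Lp_norm \<Omega> p f = (LINT x|lebesgue_on \<Omega>. norm (f x) powr p) powr (1 / p)"

definition Lp_converges ::
    "(real ^ 'n::finite) set \<Rightarrow> real \<Rightarrow> (nat \<Rightarrow> real ^ 'n \<Rightarrow> 'b::euclidean_space) \<Rightarrow> (real ^ 'n \<Rightarrow> 'b) \<Rightarrow> bool" where
  "Lp_converges \<Omega> p fs f \<longleftrightarrow>
     (\<forall>n. in_Lp \<Omega> p (fs n)) \<and> in_Lp \<Omega> p f \<and>
     (\<lambda>n. Lp_norm \<Omega> p (\<lambda>x. fs n x - f x)) \<longlonglongrightarrow> 0"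

fun Ck :: "nat \<Rightarrow> (real ^ 'n::finite \<Rightarrow> real) \<Rightarrow> bool" where
  "Ck 0 u \<longleftrightarrow> continuous_on UNIV u"
| "Ck (Suc k) u \<longleftrightarrow> (\<forall>x. u differentiable (at x)) \<and> (\<forall>i. Ck k (partial_deriv i u))"

definition test_functions :: "(real ^ 'n::finite) set \<Rightarrow> (real ^ 'n \<Rightarrow> real) set" where
  "test_functions \<Omega> =
     {\<phi>. (\<forall>k. Ck k \<phi>) \<and> compact (closure {x. \<phi> x \<noteq> 0}) \<and> closure {x. \<phi> x \<noteq> 0} \<subseteq> \<Omega>}"

text \<open>
  \<open>W0_grad c \<Omega> p u G\<close>: \<open>u\<close> lies in the closure of the test functions, with \<open>Xu = G\<close>.
  Under the Sobolev inequality on the bounded set \<open>\<Omega>\<close>, a sequence of test functions that is Cauchy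
  for \<open>\<parallel>Xu\<parallel>\<^sub>p\<close> (\<open>1 \<le> p < Q\<close>) converges in \<open>L\<^sup>p\<close>, so requiring \<open>\<phi>\<^sub>n \<longlonglongrightarrow> u\<close> in \<open>L\<^sup>p\<close> only
  identifies the abstract limit with a function.
\<close>

definition W0_grad ::
    "('n::finite, 'm::finite) vfields \<Rightarrow> (real ^ 'n) set \<Rightarrow> real \<Rightarrow> (real ^ 'n \<Rightarrow> real) \<Rightarrow> (real ^ 'n \<Rightarrow> real ^ 'm) \<Rightarrow> bool" where
  "W0_grad c \<Omega> p u G \<longleftrightarrow>
     (\<exists>\<phi>. (\<forall>n. \<phi> n \<in> test_functions \<Omega>) \<and>
        Lp_converges \<Omega> p \<phi> u \<and> Lp_converges \<Omega> p (\<lambda>n. Xgrad c (\<phi> n)) G)"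

definition W0 :: "('n::finite, 'm::finite) vfields \<Rightarrow> (real ^ 'n) set \<Rightarrow> real \<Rightarrow> (real ^ 'n \<Rightarrow> real) set" where
  "W0 c \<Omega> p = {u. \<exists>G. W0_grad c \<Omega> p u G}"

definition sobolev_exponent :: "real \<Rightarrow> real \<Rightarrow> real" where
  "sobolev_exponent Q p = p * Q / (Q - p)"

definition sobolev_inequality :: "('n::finite, 'm::finite) vfields \<Rightarrow> (real ^ 'n) set \<Rightarrow> real \<Rightarrow> bool" where
  "sobolev_inequality c \<Omega> Q \<longleftrightarrow>
     (\<forall>p. 1 \<le> p \<and> p < Q \<longrightarrow>
        (\<exists>S. \<forall>u G. W0_grad c \<Omega> p u G \<longrightarrow>
           in_Lp \<Omega> (sobolev_exponent Q p) u \<and>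
           Lp_norm \<Omega> (sobolev_exponent Q p) u \<le> S * Lp_norm \<Omega> p G))"

text \<open>Continuous linear functionals on \<open>W0\<close> normed by \<open>\<parallel>Xv\<parallel>\<^sub>q\<close>; values off \<open>W0\<close> are irrelevant.\<close>

definition W0_dual ::
    "('n::finite, 'm::finite) vfields \<Rightarrow> (real ^ 'n) set \<Rightarrow> real \<Rightarrow> ((real ^ 'n \<Rightarrow> real) \<Rightarrow> real) \<Rightarrow> bool" where
  "W0_dual c \<Omega> q l \<longleftrightarrow>
     (\<forall>v\<in>W0 c \<Omega> q. \<forall>w\<in>W0 c \<Omega> q. l (\<lambda>x. v x + w x) = l v + l w) \<and>
     (\<forall>a. \<forall>v\<in>W0 c \<Omega> q. l (\<lambda>x. a * v x) = a * l v) \<and>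
     (\<exists>K. \<forall>v G. W0_grad c \<Omega> q v G \<longrightarrow> \<bar>l v\<bar> \<le> K * Lp_norm \<Omega> q G)"

definition W0_weakly_converges ::
    "('n::finite, 'm::finite) vfields \<Rightarrow> (real ^ 'n) set \<Rightarrow> real \<Rightarrow> (nat \<Rightarrow> real ^ 'n \<Rightarrow> real) \<Rightarrow> (real ^ 'n \<Rightarrow> real) \<Rightarrow> bool" where
  "W0_weakly_converges c \<Omega> q us u \<longleftrightarrow>
     (\<forall>n. us n \<in> W0 c \<Omega> q) \<and> u \<in> W0 c \<Omega> q \<and>
     (\<forall>l. W0_dual c \<Omega> q l \<longrightarrow> (\<lambda>n. l (us n)) \<longlonglongrightarrow> l u)"

definition admissible_matrix :: "(real ^ 'n::finite) set \<Rightarrow> (real ^ 'n \<Rightarrow> real ^ 'm ^ 'm::finite) \<Rightarrow> real \<Rightarrow> real \<Rightarrow> bool" where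
  "admissible_matrix \<Omega> A \<alpha> \<beta> \<longleftrightarrow>
     A \<in> borel_measurable (lebesgue_on \<Omega>) \<and>
     (\<exists>M. \<forall>x\<in>\<Omega>. \<forall>i j. \<bar>A x $ i $ j\<bar> \<le> M) \<and>
     0 < \<alpha> \<and> \<alpha> < \<beta> \<and>
     (\<forall>x\<in>\<Omega>. \<forall>\<eta>. \<alpha> * (norm \<eta>)\<^sup>2 \<le> (A x *v \<eta>) \<bullet> \<eta> \<and> (A x *v \<eta>) \<bullet> \<eta> \<le> \<beta> * (norm \<eta>)\<^sup>2)"

text \<open>The equation \<open>X\<^sup>*(A Xu) = h\<close> is tested against \<open>v\<close> through \<open>\<langle>X\<^sup>*F, v\<rangle> = \<integral> F \<bullet> Xv\<close>; the boundary
  condition is membership in the closure of the test functions.\<close>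

definition weak_solution ::
    "('n::finite, 'm::finite) vfields \<Rightarrow> (real ^ 'n) set \<Rightarrow> real \<Rightarrow> (real ^ 'n \<Rightarrow> real ^ 'm ^ 'm)
      \<Rightarrow> (real ^ 'n \<Rightarrow> real) \<Rightarrow> (real ^ 'n \<Rightarrow> real) \<Rightarrow> bool" where
  "weak_solution c \<Omega> Q A h u \<longleftrightarrow>
     in_Lp \<Omega> (2 * Q / (Q + 2)) h \<and>
     (\<exists>G. W0_grad c \<Omega> 2 u G \<and>
        (\<forall>v H. W0_grad c \<Omega> 2 v H \<longrightarrow>
           (LINT x|lebesgue_on \<Omega>. (A x *v G x) \<bullet> H x) = (LINT x|lebesgue_on \<Omega>. h x * v x)))"

definition truncation :: "(real ^ 'n \<Rightarrow> real) \<Rightarrow> nat \<Rightarrow> real ^ 'n \<Rightarrow> real" where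
  "truncation f n x = max (- real n) (min (f x) (real n))"

definition solution_by_approximation ::
    "('n::finite, 'm::finite) vfields \<Rightarrow> (real ^ 'n) set \<Rightarrow> real \<Rightarrow> (real ^ 'n \<Rightarrow> real ^ 'm ^ 'm)
      \<Rightarrow> (real ^ 'n \<Rightarrow> real) \<Rightarrow> (real ^ 'n \<Rightarrow> real) \<Rightarrow> bool" where
  "solution_by_approximation c \<Omega> Q A f u \<longleftrightarrow>
     in_Lp \<Omega> 1 f \<and>
     (\<exists>us. (\<forall>n. weak_solution c \<Omega> Q A (truncation f n) (us n)) \<and>
        (\<exists>\<sigma>. strict_mono \<sigma> \<and>
           (\<forall>q. 1 < q \<and> q < Q / (Q - 1) \<longrightarrow> W0_weakly_converges c \<Omega> q (us \<circ> \<sigma>) u) \<and>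
           (\<forall>s. 1 \<le> s \<and> s < Q / (Q - 2) \<longrightarrow> Lp_converges \<Omega> s (us \<circ> \<sigma>) u)))"

end

theory Submission
  imports Defs
begin

text \<open>
  The equation is linear, so the difference of two approximations \<open>u\<^sub>n - u\<^sub>m\<close> solves the equation with
  datum \<open>f\<^sub>n - f\<^sub>m\<close>, and the truncations \<open>f\<^sub>n\<close> converge to \<open>f\<close> in \<open>L\<^sup>p\<close>. Hence one a priori bound, namely
  that the \<open>L\<^bsup>p*\<^esup>\<close> norms of a weak solution and of its \<open>X\<close>-gradient are controlled by the \<open>L\<^sup>p\<close> norm of
  its datum (\<open>gradient_estimate\<close>), makes \<open>u\<^sub>n\<close> a Cauchy sequence in \<open>W\<^sub>0\<close> with exponent \<open>p*\<close>. Completeness of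
  \<open>L\<^bsup>p*\<^esup>\<close> (\<open>Lp_complete\<close>) and a diagonal argument (\<open>W0_grad_closed\<close>) show that the limit is in this
  space, and it is \<open>u\<close> because \<open>u\<^sub>n\<close> tends to \<open>u\<close> in \<open>L\<^sup>1\<close> along a subsequence.

  For the a priori bound, put \<open>s = Q(p - 1)/(Q - 2p)\<close>, which lies in \<open>(0, 1)\<close> exactly because
  \<open>1 < p < 2Q/(Q + 2)\<close>. Testing with \<open>v \<approx> |u|\<^sup>s sgn u\<close> and using ellipticity gives
  \<open>E = \<integral> |Xu|\<^sup>2 (1 + u\<^sup>2)\<^bsup>(s - 1)/2\<^esup> \<le> C \<integral> f v\<close>, and by the Hoelder inequality the right-hand side
  is at most a multiple of the \<open>1/p'\<close>-th power of \<open>\<integral> |v|\<^bsup>p'\<^esup>\<close>, that is, of \<open>\<integral> |u|\<^sup>r\<close> with \<open>r = s p'\<close>. As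
  \<open>E\<close> dominates the energy of \<open>|u|\<^bsup>(1 + s)/2\<^esup>\<close>, the Sobolev inequality with exponent \<open>2\<close> controls the same integral
  \<open>\<integral> |u|\<^sup>r\<close> by \<open>E\<^bsup>Q/(Q - 2)\<^esup>\<close>: the value of \<open>s\<close> makes the two powers of \<open>u\<close> agree. Altogether
  \<open>E\<close> is bounded by a power of itself with exponent \<open>Q/((Q - 2) p') < 1\<close>, hence bounded
  (\<open>absorb_sublinear_power\<close>). Finally \<open>|Xu|\<^bsup>p*\<^esup>\<close> is interpolated between the integrands of \<open>E\<close> and of
  \<open>\<integral> |u|\<^sup>r\<close>.

  Since \<open>W\<^sub>0\<close> is a closure of smooth functions, admissibility of \<open>v\<close> rests on a chain rule for functions
  that map test functions to test functions; therefore \<open>|t|\<^sup>s sgn t\<close> is replaced by the smooth function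
  \<open>t (1 + t\<^sup>2)\<^bsup>(s - 1)/2\<^esup>\<close>.
\<close>

section \<open>Convergence in \<open>L\<^sup>p\<close> through integrals of powers\<close>

lemma norm_diff_powr_le:
  fixes a b :: "'b::real_normed_vector"
  assumes "p > 0"
  shows "norm (a - b) powr p \<le> 2 powr p * (norm a powr p + norm b powr p)"
proof -
  define M where "M = max (norm a) (norm b)"
  have "norm (a - b) \<le> 2 * M"
    using norm_triangle_ineq4[of a b] unfolding M_def by linarith
  then have "norm (a - b) powr p \<le> (2 * M) powr p"
    using assms by (intro powr_mono2) auto
  also have "\<dots> = 2 powr p * M powr p"
    by (simp add: powr_mult M_def)
  also have "M powr p \<le> norm a powr p + norm b powr p"
    unfolding M_def by (simp add: max_def)
  finally show ?thesis by simp
qed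

lemma tendsto_0_nonneg_le:
  fixes a b :: "nat \<Rightarrow> real"
  assumes "\<And>n. 0 \<le> a n" "\<And>n. a n \<le> b n" "b \<longlonglongrightarrow> 0"
  shows "a \<longlonglongrightarrow> 0"
  by (rule tendsto_sandwich[OF _ _ tendsto_const assms(3)]) (simp_all add: assms)

text \<open>The dichotomy \<open>x \<le> \<delta>\<close> or \<open>x \<ge> \<delta>\<close>; on a set of finite measure it replaces the Hoelder
  inequality in comparisons of \<open>L\<^sup>q\<close> with \<open>L\<^sup>p\<close>.\<close>

lemma powr_le_split:
  fixes x :: real
  assumes "0 < q" "q \<le> p" "0 < \<delta>" "0 \<le> x"
  shows "x powr q \<le> \<delta> powr q + \<delta> powr (q - p) * x powr p"
proof (cases "x \<le> \<delta>")
  case True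
  then have "x powr q \<le> \<delta> powr q" using assms by (intro powr_mono2) auto
  then show ?thesis by (simp add: add_increasing2)
next
  case False
  then have "x powr q = x powr (q - p) * x powr p"
    using assms by (simp flip: powr_add)
  also have "x powr (q - p) \<le> \<delta> powr (q - p)"
    using assms False by (intro powr_mono2') auto
  finally show ?thesis by (simp add: add_increasing mult_right_mono)
qed

lemma in_LpI_bound:
  assumes "in_Lp \<Omega> p f" "g \<in> borel_measurable (lebesgue_on \<Omega>)" "p > 0"
    and "\<And>x. norm (g x) \<le> K * norm (f x)"
  shows "in_Lp \<Omega> p g"
proof -
  have int: "integrable (lebesgue_on \<Omega>) (\<lambda>x. \<bar>K\<bar> powr p * norm (f x) powr p)"
    using assms(1) by (simp add: in_Lp_def)
  have "integrable (lebesgue_on \<Omega>) (\<lambda>x. norm (g x) powr p)"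
  proof (rule Bochner_Integration.integrable_bound[OF int])
    show "(\<lambda>x. norm (g x) powr p) \<in> borel_measurable (lebesgue_on \<Omega>)"
      using assms(2) by measurable
    show "AE x in lebesgue_on \<Omega>. norm (norm (g x) powr p) \<le> norm (\<bar>K\<bar> powr p * norm (f x) powr p)"
    proof (rule AE_I2)
      fix x
      have "K * norm (f x) \<le> \<bar>K\<bar> * norm (f x)" by (simp add: mult_right_mono)
      then have "norm (g x) \<le> \<bar>K\<bar> * norm (f x)" using assms(4)[of x] by linarith
      then have "norm (g x) powr p \<le> (\<bar>K\<bar> * norm (f x)) powr p"
        using assms(3) by (intro powr_mono2) auto
      then show "norm (norm (g x) powr p) \<le> norm (\<bar>K\<bar> powr p * norm (f x) powr p)"
        by (simp add: powr_mult)
    qed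
  qed
  then show ?thesis using assms(2) by (simp add: in_Lp_def)
qed

lemma in_Lp_scaleR:
  "in_Lp \<Omega> p f \<Longrightarrow> p > 0 \<Longrightarrow> in_Lp \<Omega> p (\<lambda>x. a *\<^sub>R f x)"
  by (rule in_LpI_bound[where f = f and K = "\<bar>a\<bar>"]) (auto simp: in_Lp_def)

lemma in_Lp_diff:
  assumes "in_Lp \<Omega> p f" "in_Lp \<Omega> p g" "p > 0"
  shows "in_Lp \<Omega> p (\<lambda>x. f x - g x)"
proof -
  have [measurable]: "f \<in> borel_measurable (lebesgue_on \<Omega>)" "g \<in> borel_measurable (lebesgue_on \<Omega>)"
    using assms by (auto simp: in_Lp_def)
  have int: "integrable (lebesgue_on \<Omega>) (\<lambda>x. 2 powr p * (norm (f x) powr p + norm (g x) powr p))"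
    using assms by (simp add: in_Lp_def)
  have "integrable (lebesgue_on \<Omega>) (\<lambda>x. norm (f x - g x) powr p)"
    by (rule Bochner_Integration.integrable_bound[OF int])
      (use norm_diff_powr_le[OF assms(3)] in auto)
  then show ?thesis by (simp add: in_Lp_def)
qed

lemma integral_norm_diff_powr_le:
  assumes "in_Lp \<Omega> p f" "in_Lp \<Omega> p g" "in_Lp \<Omega> p h" "p > 0"
  shows "(LINT x|lebesgue_on \<Omega>. norm (f x - h x) powr p)
    \<le> 2 powr p * ((LINT x|lebesgue_on \<Omega>. norm (f x - g x) powr p) + (LINT x|lebesgue_on \<Omega>. norm (g x - h x) powr p))"
proof -
  have i: "integrable (lebesgue_on \<Omega>) (\<lambda>x. norm (f x - h x) powr p)"
    "integrable (lebesgue_on \<Omega>) (\<lambda>x. norm (f x - g x) powr p)"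
    "integrable (lebesgue_on \<Omega>) (\<lambda>x. norm (g x - h x) powr p)"
    using in_Lp_diff[OF assms(1,3,4)] in_Lp_diff[OF assms(1,2,4)] in_Lp_diff[OF assms(2,3,4)]
    by (auto simp: in_Lp_def)
  have "(LINT x|lebesgue_on \<Omega>. norm (f x - h x) powr p)
     \<le> (LINT x|lebesgue_on \<Omega>. 2 powr p * (norm (f x - g x) powr p + norm (g x - h x) powr p))"
  proof (rule integral_mono)
    fix x
    show "norm (f x - h x) powr p \<le> 2 powr p * (norm (f x - g x) powr p + norm (g x - h x) powr p)"
      using norm_diff_powr_le[OF assms(4), of "f x - g x" "h x - g x"]
      by (simp add: norm_minus_commute)
  qed (use i in auto)
  then show ?thesis using i by simp
qed

lemma Lp_converges_iff:
  assumes "p > 0"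
  shows "Lp_converges \<Omega> p fs f \<longleftrightarrow>
    (\<forall>n. in_Lp \<Omega> p (fs n)) \<and> in_Lp \<Omega> p f \<and>
    (\<lambda>n. LINT x|lebesgue_on \<Omega>. norm (fs n x - f x) powr p) \<longlonglongrightarrow> 0"
proof -
  define J where "J n = (LINT x|lebesgue_on \<Omega>. norm (fs n x - f x) powr p)" for n
  have J0: "J n \<ge> 0" for n unfolding J_def by simp
  have "(\<lambda>n. J n powr (1 / p)) \<longlonglongrightarrow> 0 \<longleftrightarrow> J \<longlonglongrightarrow> 0"
  proof
    assume "(\<lambda>n. J n powr (1 / p)) \<longlonglongrightarrow> 0"
    then have "(\<lambda>n. (J n powr (1 / p)) powr p) \<longlonglongrightarrow> 0 powr p"
      using assms by (intro tendsto_powr') auto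
    then show "J \<longlonglongrightarrow> 0" using J0 assms by (simp add: powr_powr)
  next
    assume "J \<longlonglongrightarrow> 0"
    then have "(\<lambda>n. J n powr (1 / p)) \<longlonglongrightarrow> 0 powr (1 / p)"
      using assms J0 by (intro tendsto_powr') auto
    then show "(\<lambda>n. J n powr (1 / p)) \<longlonglongrightarrow> 0" by simp
  qed
  then show ?thesis by (simp add: Lp_converges_def Lp_norm_def J_def[abs_def])
qed

lemma Lp_converges_subseq:
  "Lp_converges \<Omega> p fs f \<Longrightarrow> strict_mono r \<Longrightarrow> Lp_converges \<Omega> p (\<lambda>n. fs (r n)) f"
  unfolding Lp_converges_def using LIMSEQ_subseq_LIMSEQ[of _ 0 r] by (force simp: o_def)

lemma Lp_converges_diff:
  assumes "Lp_converges \<Omega> p fs f" "Lp_converges \<Omega> p gs g" "p > 0"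
  shows "Lp_converges \<Omega> p (\<lambda>n x. a *\<^sub>R (fs n x - gs n x)) (\<lambda>x. a *\<^sub>R (f x - g x))"
proof -
  have in_Lp: "in_Lp \<Omega> p f" "in_Lp \<Omega> p g" "in_Lp \<Omega> p (fs n)" "in_Lp \<Omega> p (gs n)" for n
    using assms(1,2) by (auto simp: Lp_converges_def)
  let ?F = "\<lambda>n. LINT x|lebesgue_on \<Omega>. norm (fs n x - f x) powr p"
  let ?G = "\<lambda>n. LINT x|lebesgue_on \<Omega>. norm (gs n x - g x) powr p"
  have lim: "?F \<longlonglongrightarrow> 0" "?G \<longlonglongrightarrow> 0"
    using assms by (auto simp: Lp_converges_iff)
  have "(LINT x|lebesgue_on \<Omega>. norm (a *\<^sub>R (fs n x - gs n x) - a *\<^sub>R (f x - g x)) powr p)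
      \<le> \<bar>a\<bar> powr p * (2 powr p * (?F n + ?G n))" for n
  proof -
    have i: "integrable (lebesgue_on \<Omega>) (\<lambda>x. norm (fs n x - f x) powr p)"
      "integrable (lebesgue_on \<Omega>) (\<lambda>x. norm (gs n x - g x) powr p)"
      using in_Lp_diff[OF in_Lp(3) in_Lp(1) assms(3), of n] in_Lp_diff[OF in_Lp(4) in_Lp(2) assms(3), of n]
      by (auto simp: in_Lp_def)
    have "in_Lp \<Omega> p (\<lambda>x. a *\<^sub>R (fs n x - gs n x) - a *\<^sub>R (f x - g x))"
      by (intro in_Lp_diff in_Lp_scaleR in_Lp assms)
    then have "(LINT x|lebesgue_on \<Omega>. norm (a *\<^sub>R (fs n x - gs n x) - a *\<^sub>R (f x - g x)) powr p)
      \<le> (LINT x|lebesgue_on \<Omega>. \<bar>a\<bar> powr p * (2 powr p * (norm (fs n x - f x) powr p + norm (gs n x - g x) powr p)))"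
    proof (intro integral_mono)
      fix x
      have eq: "a *\<^sub>R (fs n x - gs n x) - a *\<^sub>R (f x - g x) = a *\<^sub>R ((fs n x - f x) - (gs n x - g x))"
        by (simp add: algebra_simps)
      show "norm (a *\<^sub>R (fs n x - gs n x) - a *\<^sub>R (f x - g x)) powr p
        \<le> \<bar>a\<bar> powr p * (2 powr p * (norm (fs n x - f x) powr p + norm (gs n x - g x) powr p))"
        unfolding eq norm_scaleR powr_mult
        using norm_diff_powr_le[OF assms(3), of "fs n x - f x" "gs n x - g x"]
        by (intro mult_left_mono) auto
    qed (use i in \<open>auto simp: in_Lp_def\<close>)
    then show ?thesis using i by simp
  qed
  moreover have "(\<lambda>n. \<bar>a\<bar> powr p * (2 powr p * (?F n + ?G n))) \<longlonglongrightarrow> 0"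
    using tendsto_mult[OF tendsto_const tendsto_mult[OF tendsto_const tendsto_add[OF lim]],
        of "\<bar>a\<bar> powr p" "2 powr p"] by simp
  ultimately have "(\<lambda>n. LINT x|lebesgue_on \<Omega>. norm (a *\<^sub>R (fs n x - gs n x) - a *\<^sub>R (f x - g x)) powr p) \<longlonglongrightarrow> 0"
    by (rule tendsto_0_nonneg_le[rotated]) simp
  then show ?thesis using assms(3) in_Lp
    by (auto simp: Lp_converges_iff intro!: in_Lp_scaleR in_Lp_diff)
qed

section \<open>Finite measure: comparison of exponents and completeness\<close>

lemma finite_measure_lebesgue_on_bounded_open:
  fixes \<Omega> :: "'a::euclidean_space set"
  assumes "open \<Omega>" "bounded \<Omega>"
  shows "finite_measure (lebesgue_on \<Omega>)"
  using assms by (intro finite_measure_lebesgue_on lmeasurable_open)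

lemma in_Lp_lower_exponent:
  assumes "finite_measure (lebesgue_on \<Omega>)" "in_Lp \<Omega> p f" "0 < q" "q \<le> p"
  shows "in_Lp \<Omega> q f"
proof -
  interpret finite_measure "lebesgue_on \<Omega>" by fact
  have [measurable]: "f \<in> borel_measurable (lebesgue_on \<Omega>)"
    using assms by (auto simp: in_Lp_def)
  have int: "integrable (lebesgue_on \<Omega>) (\<lambda>x. 1 + norm (f x) powr p)"
    using assms by (simp add: in_Lp_def)
  have "integrable (lebesgue_on \<Omega>) (\<lambda>x. norm (f x) powr q)"
    by (rule Bochner_Integration.integrable_bound[OF int])
      (use powr_le_split[OF assms(3,4), of 1] in auto)
  then show ?thesis by (simp add: in_Lp_def)
qed

lemma Lp_converges_lower_exponent:
  assumes "finite_measure (lebesgue_on \<Omega>)" "Lp_converges \<Omega> p fs f" "0 < q" "q \<le> p"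
  shows "Lp_converges \<Omega> q fs f"
proof -
  interpret finite_measure "lebesgue_on \<Omega>" by fact
  have p: "p > 0" using assms by simp
  define J where "J n = (LINT x|lebesgue_on \<Omega>. norm (fs n x - f x) powr p)" for n
  define m where "m = measure (lebesgue_on \<Omega>) (space (lebesgue_on \<Omega>))"
  have in_Lp: "in_Lp \<Omega> p f" "in_Lp \<Omega> p (fs n)" for n
    using assms(2) by (auto simp: Lp_converges_def)
  have lim: "J \<longlonglongrightarrow> 0"
    using assms p by (auto simp: Lp_converges_iff J_def[abs_def])
  have le: "(LINT x|lebesgue_on \<Omega>. norm (fs n x - f x) powr q) \<le> \<delta> powr q * m + \<delta> powr (q - p) * J n"
    if "\<delta> > 0" for n \<delta>
  proof -
    have i: "in_Lp \<Omega> p (\<lambda>x. fs n x - f x)" by (intro in_Lp_diff in_Lp p)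
    have "in_Lp \<Omega> q (\<lambda>x. fs n x - f x)"
      by (rule in_Lp_lower_exponent[OF assms(1) i assms(3,4)])
    with i have "(LINT x|lebesgue_on \<Omega>. norm (fs n x - f x) powr q)
       \<le> (LINT x|lebesgue_on \<Omega>. \<delta> powr q + \<delta> powr (q - p) * norm (fs n x - f x) powr p)"
      using powr_le_split[OF assms(3,4) that] by (intro integral_mono) (auto simp: in_Lp_def)
    also have "\<dots> = \<delta> powr q * m + \<delta> powr (q - p) * J n"
      using i by (simp add: in_Lp_def J_def m_def)
    finally show ?thesis .
  qed
  have "(\<lambda>n. LINT x|lebesgue_on \<Omega>. norm (fs n x - f x) powr q) \<longlonglongrightarrow> 0"
  proof (rule tendstoI)
    fix e :: real assume e: "e > 0"
    define \<delta> where "\<delta> = (e / (2 * (m + 1))) powr (1 / q)"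
    have m: "m \<ge> 0" by (simp add: m_def)
    have \<delta>: "\<delta> > 0" using e m by (simp add: \<delta>_def)
    have "\<delta> powr q * m = e / 2 * (m / (m + 1))"
      using e m assms(3) by (simp add: \<delta>_def powr_powr)
    also have "\<dots> \<le> e / 2 * 1"
      using e m by (intro mult_left_mono) (auto simp: divide_simps)
    finally have 1: "\<delta> powr q * m \<le> e / 2" by simp
    have "(\<lambda>n. \<delta> powr (q - p) * J n) \<longlonglongrightarrow> \<delta> powr (q - p) * 0"
      by (intro tendsto_intros lim)
    then have "eventually (\<lambda>n. \<delta> powr (q - p) * J n < e / 2) sequentially"
      using e by (intro order_tendstoD(2)) auto
    then show "eventually (\<lambda>n. dist (LINT x|lebesgue_on \<Omega>. norm (fs n x - f x) powr q) 0 < e) sequentially"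
    proof eventually_elim
      case (elim n)
      then show ?case using le[OF \<delta>, of n] 1 by simp
    qed
  qed
  then show ?thesis
    using in_Lp assms(1,3,4) by (auto simp: Lp_converges_iff intro: in_Lp_lower_exponent)
qed

lemma Lp_converges_AE_subseq:
  assumes "finite_measure (lebesgue_on \<Omega>)" "Lp_converges \<Omega> p fs f" "1 \<le> p"
  shows "\<exists>r. strict_mono r \<and> (AE x in lebesgue_on \<Omega>. (\<lambda>n. fs (r n) x) \<longlonglongrightarrow> f x)"
proof -
  have 1: "Lp_converges \<Omega> 1 fs f"
    by (rule Lp_converges_lower_exponent[OF assms(1,2)]) (use assms(3) in auto)
  then have "\<forall>n. in_Lp \<Omega> 1 (\<lambda>x. fs n x - f x)"
    by (auto simp: Lp_converges_def intro: in_Lp_diff)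
  then have "\<And>n. integrable (lebesgue_on \<Omega>) (\<lambda>x. fs n x - f x)"
    by (auto simp: in_Lp_def intro: integrable_norm_cancel)
  moreover have "(\<lambda>n. LINT x|lebesgue_on \<Omega>. norm (fs n x - f x)) \<longlonglongrightarrow> 0"
    using 1 by (simp add: Lp_converges_iff)
  ultimately obtain r :: "nat \<Rightarrow> nat" where "strict_mono r"
    "AE x in lebesgue_on \<Omega>. (\<lambda>n. fs (r n) x - f x) \<longlonglongrightarrow> 0"
    using tendsto_L1_AE_subseq[of "lebesgue_on \<Omega>" "\<lambda>n x. fs n x - f x"] by auto
  then show ?thesis by (auto simp: LIM_zero_iff)
qed

text \<open>A sequence that is Cauchy in \<open>L\<^sup>p\<close> converges to whatever function it reaches almost everywhere
  along a subsequence: Fatou's lemma turns the Cauchy bound for \<open>fs n - fs m\<close> into one for \<open>fs n - g\<close>.\<close>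

lemma Lp_Cauchy_AE_limit:
  fixes fs :: "nat \<Rightarrow> real ^ 'n::finite \<Rightarrow> 'b::euclidean_space"
  assumes "p > 0" "\<And>n. in_Lp \<Omega> p (fs n)" "g \<in> borel_measurable (lebesgue_on \<Omega>)"
    and Cauchy: "\<And>e. e > 0 \<Longrightarrow> \<exists>N. \<forall>m\<ge>N. \<forall>n\<ge>N. (LINT x|lebesgue_on \<Omega>. norm (fs m x - fs n x) powr p) < e"
    and r: "strict_mono r" and AE: "AE x in lebesgue_on \<Omega>. (\<lambda>n. fs (r n) x) \<longlonglongrightarrow> g x"
  shows "Lp_converges \<Omega> p fs g"
proof -
  let ?M = "lebesgue_on \<Omega>"
  have [measurable]: "g \<in> borel_measurable ?M" "\<And>n. fs n \<in> borel_measurable ?M"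
    using assms(2,3) by (auto simp: in_Lp_def)
  have int: "integrable ?M (\<lambda>x. norm (fs m x - fs n x) powr p)" for m n
    using in_Lp_diff[OF assms(2) assms(2) assms(1), of m n] by (simp add: in_Lp_def)
  have key: "(\<integral>\<^sup>+x. ennreal (norm (fs n x - g x) powr p) \<partial>?M) \<le> ennreal e"
    if N: "\<forall>m\<ge>N. \<forall>n\<ge>N. (LINT x|?M. norm (fs m x - fs n x) powr p) < e" and n: "n \<ge> N" for n N e
  proof -
    have "(\<integral>\<^sup>+x. ennreal (norm (fs n x - g x) powr p) \<partial>?M)
       = (\<integral>\<^sup>+x. liminf (\<lambda>k. ennreal (norm (fs n x - fs (r k) x) powr p)) \<partial>?M)"
    proof (rule nn_integral_cong_AE, use AE in eventually_elim)
      case (elim x)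
      have "(\<lambda>k. norm (fs n x - fs (r k) x) powr p) \<longlonglongrightarrow> norm (fs n x - g x) powr p"
        using assms(1) by (intro tendsto_powr' tendsto_norm tendsto_diff tendsto_const elim) auto
      then have "(\<lambda>k. ennreal (norm (fs n x - fs (r k) x) powr p)) \<longlonglongrightarrow> ennreal (norm (fs n x - g x) powr p)"
        by (rule tendsto_ennrealI)
      then show ?case by (rule lim_imp_Liminf[OF sequentially_bot, symmetric])
    qed
    also have "\<dots> \<le> liminf (\<lambda>k. \<integral>\<^sup>+x. ennreal (norm (fs n x - fs (r k) x) powr p) \<partial>?M)"
      by (rule nn_integral_liminf) measurable
    also have "\<dots> \<le> ennreal e"
    proof (rule Liminf_le)
      show "\<forall>\<^sub>F k in sequentially. (\<integral>\<^sup>+x. ennreal (norm (fs n x - fs (r k) x) powr p) \<partial>?M) \<le> ennreal e"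
      proof (rule eventually_sequentiallyI[of N])
        fix k assume "k \<ge> N"
        then have "r k \<ge> N" using seq_suble[OF r, of k] by linarith
        then have "(LINT x|?M. norm (fs n x - fs (r k) x) powr p) < e" using N n by blast
        then show "(\<integral>\<^sup>+x. ennreal (norm (fs n x - fs (r k) x) powr p) \<partial>?M) \<le> ennreal e"
          using int by (subst nn_integral_eq_integral) (auto intro: ennreal_leI)
      qed
    qed simp
    finally show ?thesis .
  qed
  obtain N1 where N1: "\<forall>m\<ge>N1. \<forall>n\<ge>N1. (LINT x|?M. norm (fs m x - fs n x) powr p) < 1"
    using Cauchy[of 1] by auto
  have "integrable ?M (\<lambda>x. norm (fs N1 x - g x) powr p)"
    using key[OF N1, of N1] by (intro integrableI_bounded) (auto simp: less_top[symmetric] top_unique)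
  then have "in_Lp \<Omega> p (\<lambda>x. fs N1 x - g x)" by (simp add: in_Lp_def)
  from in_Lp_diff[OF assms(2)[of N1] this assms(1)] have g: "in_Lp \<Omega> p g" by simp
  have "(\<lambda>n. LINT x|?M. norm (fs n x - g x) powr p) \<longlonglongrightarrow> 0"
  proof (rule LIMSEQ_I)
    fix e :: real assume "e > 0"
    then obtain N where N: "\<forall>m\<ge>N. \<forall>n\<ge>N. (LINT x|?M. norm (fs m x - fs n x) powr p) < e / 2"
      using Cauchy[of "e / 2"] by auto
    have "norm ((LINT x|?M. norm (fs n x - g x) powr p) - 0) < e" if "n \<ge> N" for n
    proof -
      have "integrable ?M (\<lambda>x. norm (fs n x - g x) powr p)"
        using in_Lp_diff[OF assms(2) g assms(1)] by (simp add: in_Lp_def)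
      then have "ennreal (LINT x|?M. norm (fs n x - g x) powr p) \<le> ennreal (e / 2)"
        using key[OF N that] by (simp add: nn_integral_eq_integral)
      then show ?thesis using \<open>e > 0\<close> by (simp add: ennreal_le_iff)
    qed
    then show "\<exists>N. \<forall>n\<ge>N. norm ((LINT x|?M. norm (fs n x - g x) powr p) - 0) < e" by blast
  qed
  then show ?thesis using assms(1,2) g by (simp add: Lp_converges_iff)
qed

text \<open>On a set of finite measure the sequence is also Cauchy in \<open>L\<^sup>1\<close>, which supplies the subsequence
  that converges almost everywhere.\<close>

lemma Lp_complete:
  fixes fs :: "nat \<Rightarrow> real ^ 'n::finite \<Rightarrow> 'b::euclidean_space"
  assumes fin: "finite_measure (lebesgue_on \<Omega>)" and p: "1 \<le> p" and in_Lp: "\<And>n. in_Lp \<Omega> p (fs n)"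
    and Cauchy: "\<And>e. e > 0 \<Longrightarrow> \<exists>N. \<forall>m\<ge>N. \<forall>n\<ge>N. (LINT x|lebesgue_on \<Omega>. norm (fs m x - fs n x) powr p) < e"
  shows "\<exists>g. Lp_converges \<Omega> p fs g"
proof -
  interpret finite_measure "lebesgue_on \<Omega>" by fact
  let ?M = "lebesgue_on \<Omega>"
  define m where "m = measure ?M (space ?M)"
  have m: "m \<ge> 0" by (simp add: m_def)
  have [measurable]: "\<And>n. fs n \<in> borel_measurable ?M"
    using in_Lp by (auto simp: in_Lp_def)
  have in_L1: "in_Lp \<Omega> 1 (fs n)" for n
    using in_Lp_lower_exponent[OF fin in_Lp, of 1] p by auto
  have int: "integrable ?M (fs n)" for n
    using in_L1[of n] by (simp add: in_Lp_def integrable_norm_iff)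
  have L1: "\<exists>N. \<forall>i\<ge>N. \<forall>j\<ge>N. (LINT x|?M. norm (fs i x - fs j x)) < e" if e: "e > 0" for e
  proof -
    define \<delta> where "\<delta> = e / (2 * (m + 1))"
    have \<delta>: "\<delta> > 0" using e m by (simp add: \<delta>_def)
    have "\<delta> * m = e / 2 * (m / (m + 1))" using m by (simp add: \<delta>_def)
    also have "\<dots> \<le> e / 2 * 1"
      using e m by (intro mult_left_mono) (auto simp: divide_simps)
    finally have 1: "\<delta> * m \<le> e / 2" by simp
    obtain N where N: "\<forall>i\<ge>N. \<forall>j\<ge>N. (LINT x|?M. norm (fs i x - fs j x) powr p) < e / 2 / \<delta> powr (1 - p)"
      using Cauchy[of "e / 2 / \<delta> powr (1 - p)"] e \<delta> by auto
    have "(LINT x|?M. norm (fs i x - fs j x)) < e" if "i \<ge> N" "j \<ge> N" for i j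
    proof -
      have i: "integrable ?M (\<lambda>x. norm (fs i x - fs j x) powr p)"
        using in_Lp_diff[OF in_Lp in_Lp, of i j] p by (simp add: in_Lp_def)
      have "(LINT x|?M. norm (fs i x - fs j x))
         \<le> (LINT x|?M. \<delta> + \<delta> powr (1 - p) * norm (fs i x - fs j x) powr p)"
        using powr_le_split[of 1 p \<delta>] p \<delta> i int by (intro integral_mono) auto
      also have "\<dots> = \<delta> * m + \<delta> powr (1 - p) * (LINT x|?M. norm (fs i x - fs j x) powr p)"
        using i by (simp add: m_def)
      also have "\<dots> < \<delta> * m + \<delta> powr (1 - p) * (e / 2 / \<delta> powr (1 - p))"
        using N that \<delta> by (intro add_strict_left_mono mult_strict_left_mono) auto
      also have "\<dots> \<le> e" using 1 \<delta> by simp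
      finally show ?thesis .
    qed
    then show ?thesis by blast
  qed
  obtain r where r: "strict_mono r" and AE: "AE x in ?M. Cauchy (\<lambda>i. fs (r i) x)"
    using cauchy_L1_AE_cauchy_subseq[OF int L1] by blast
  define g where "g x = lim (\<lambda>i. fs (r i) x)" for x
  have "g \<in> borel_measurable ?M" unfolding g_def by measurable
  moreover have "AE x in ?M. (\<lambda>i. fs (r i) x) \<longlonglongrightarrow> g x"
    using AE by eventually_elim (simp add: g_def Cauchy_convergent_iff convergent_LIMSEQ_iff)
  ultimately show ?thesis
    using Lp_Cauchy_AE_limit[OF _ in_Lp _ Cauchy r] p by fastforce
qed

section \<open>Smooth functions and test functions\<close>

lemma partial_deriv_eq:
  "(w has_derivative D) (at x) \<Longrightarrow> partial_deriv i w x = D (axis i 1)"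
  by (simp add: partial_deriv_def frechet_derivative_at[symmetric])

lemma Ck_Suc_imp_Ck: "Ck (Suc k) w \<Longrightarrow> Ck k w"
proof (induction k arbitrary: w)
  case 0
  then show ?case
    by (auto intro!: differentiable_imp_continuous_on simp: differentiable_on_def)
qed auto

lemma Ck_const: "Ck k (\<lambda>_. a)"
proof (induction k arbitrary: a)
  case (Suc k)
  have "partial_deriv i (\<lambda>_. a) = (\<lambda>_. 0)" for i :: 'a
    by (rule ext, subst partial_deriv_eq[OF has_derivative_const]) simp
  with Suc show ?case by simp
qed simp

lemma Ck_add: "Ck k v \<Longrightarrow> Ck k w \<Longrightarrow> Ck k (\<lambda>x. v x + w x)"
proof (induction k arbitrary: v w)
  case (Suc k)
  have "partial_deriv i (\<lambda>x. v x + w x) = (\<lambda>x. partial_deriv i v x + partial_deriv i w x)" for i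
  proof
    fix x
    have "(v has_derivative frechet_derivative v (at x)) (at x)"
      "(w has_derivative frechet_derivative w (at x)) (at x)"
      using Suc.prems by (auto simp flip: frechet_derivative_works)
    from partial_deriv_eq[OF has_derivative_add[OF this]]
    show "partial_deriv i (\<lambda>x. v x + w x) x = partial_deriv i v x + partial_deriv i w x"
      by (simp add: partial_deriv_def)
  qed
  with Suc show ?case by auto
qed (auto intro: continuous_intros)

lemma Ck_mult: "Ck k v \<Longrightarrow> Ck k w \<Longrightarrow> Ck k (\<lambda>x. v x * w x)"
proof (induction k arbitrary: v w)
  case (Suc k)
  have "partial_deriv i (\<lambda>x. v x * w x) = (\<lambda>x. v x * partial_deriv i w x + partial_deriv i v x * w x)" for i
  proof
    fix x
    have "(v has_derivative frechet_derivative v (at x)) (at x)"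
      "(w has_derivative frechet_derivative w (at x)) (at x)"
      using Suc.prems by (auto simp flip: frechet_derivative_works)
    from partial_deriv_eq[OF has_derivative_mult[OF this]]
    show "partial_deriv i (\<lambda>x. v x * w x) x = v x * partial_deriv i w x + partial_deriv i v x * w x"
      by (simp add: partial_deriv_def)
  qed
  moreover have "Ck k v" "Ck k w" using Suc.prems Ck_Suc_imp_Ck by blast+
  ultimately show ?case using Suc by (auto intro!: Ck_add)
qed (auto intro: continuous_intros)

text \<open>The functions \<open>P(t) (1 + t\<^sup>2)\<^sup>b\<close> with \<open>P\<close> a polynomial form a class closed under
  differentiation, so that the induction over the order of differentiability stays inside it.\<close>

lemma DERIV_poly_powr:
  "((\<lambda>t::real. poly P t * (1 + t\<^sup>2) powr b) has_real_derivative
     poly (pderiv P * [:1, 0, 1:] + smult (2 * b) ([:0, 1:] * P)) t * (1 + t\<^sup>2) powr (b - 1)) (at t)"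
proof -
  have pos: "1 + t\<^sup>2 > 0" by (simp add: add_pos_nonneg)
  have "((\<lambda>t::real. poly P t * (1 + t\<^sup>2) powr b) has_real_derivative
     poly (pderiv P) t * (1 + t\<^sup>2) powr b + poly P t * (b * (1 + t\<^sup>2) powr (b - 1) * (2 * t))) (at t)"
    using pos by (auto intro!: derivative_eq_intros simp: field_simps powr_diff)
  moreover have "(1 + t\<^sup>2) powr b = (1 + t\<^sup>2) * (1 + t\<^sup>2) powr (b - 1)"
    using pos by (simp add: powr_diff)
  ultimately show ?thesis
    by (simp add: algebra_simps power2_eq_square)
qed

lemma Ck_poly_powr_compose:
  "Ck k w \<Longrightarrow> Ck k (\<lambda>x. poly P (w x) * (1 + (w x)\<^sup>2) powr b)"
proof (induction k arbitrary: P b)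
  case 0
  have "1 + (w x)\<^sup>2 \<noteq> 0" for x by (metis add_pos_nonneg less_irrefl zero_le_power2 zero_less_one)
  then show ?case using 0 by (auto intro!: continuous_intros continuous_on_poly)
next
  case (Suc k)
  define P' where "P' = pderiv P * [:1, 0, 1:] + smult (2 * b) ([:0, 1:] * P)"
  have der: "((\<lambda>x. poly P (w x) * (1 + (w x)\<^sup>2) powr b) has_derivative
      (\<lambda>h. frechet_derivative w (at x) h * (poly P' (w x) * (1 + (w x)\<^sup>2) powr (b - 1)))) (at x)" for x
    unfolding P'_def
    using Suc.prems
    by (intro DERIV_compose_FDERIV[OF DERIV_poly_powr]) (auto simp flip: frechet_derivative_works)
  have "partial_deriv i (\<lambda>x. poly P (w x) * (1 + (w x)\<^sup>2) powr b)
      = (\<lambda>x. partial_deriv i w x * (poly P' (w x) * (1 + (w x)\<^sup>2) powr (b - 1)))" for i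
    by (rule ext, subst partial_deriv_eq[OF der]) (simp add: partial_deriv_def)
  moreover have "Ck k (\<lambda>x. partial_deriv i w x * (poly P' (w x) * (1 + (w x)\<^sup>2) powr (b - 1)))" for i
    using Suc.prems Ck_Suc_imp_Ck by (intro Ck_mult[OF _ Suc.IH]) auto
  ultimately show ?case
    using der by (auto simp: differentiable_def simp del: Ck.simps(1))
qed

lemma test_functions_differentiable: "w \<in> test_functions \<Omega> \<Longrightarrow> w differentiable (at x)"
  unfolding test_functions_def by (metis (mono_tags, lifting) Ck.simps(2) mem_Collect_eq)

lemma test_functions_compose:
  assumes "w \<in> test_functions \<Omega>" "\<And>k. Ck k (\<lambda>x. h (w x))" "h 0 = 0"
  shows "(\<lambda>x. h (w x)) \<in> test_functions \<Omega>"
proof -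
  have sub: "closure {x. h (w x) \<noteq> 0} \<subseteq> closure {x. w x \<noteq> 0}"
    using assms(3) by (intro closure_mono) auto
  then have "compact (closure {x. h (w x) \<noteq> 0})"
    using assms(1) compact_Int_closed[of "closure {x. w x \<noteq> 0}" "closure {x. h (w x) \<noteq> 0}"]
    by (simp add: test_functions_def Int_absorb1)
  with sub assms(1,2) show ?thesis unfolding test_functions_def by blast
qed

lemma test_functions_scaled_diff:
  assumes "v \<in> test_functions \<Omega>" "w \<in> test_functions \<Omega>"
  shows "(\<lambda>x. a * (v x - w x)) \<in> test_functions \<Omega>"
proof -
  let ?S = "closure {x. v x \<noteq> 0} \<union> closure {x. w x \<noteq> 0}"
  have "compact ?S" "?S \<subseteq> \<Omega>" using assms by (auto simp: test_functions_def)
  have "Ck k (\<lambda>x. a * (v x + (- 1) * w x))" for k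
    using assms by (intro Ck_mult Ck_add Ck_const) (auto simp: test_functions_def)
  then have Ck: "Ck k (\<lambda>x. a * (v x - w x))" for k by simp
  have sub: "closure {x. a * (v x - w x) \<noteq> 0} \<subseteq> ?S"
    unfolding closure_Un[symmetric] by (intro closure_mono) auto
  then have "compact (closure {x. a * (v x - w x) \<noteq> 0})"
    using \<open>compact ?S\<close> compact_Int_closed[of ?S "closure {x. a * (v x - w x) \<noteq> 0}"]
    by (simp only: Int_absorb1 closed_closure)
  with sub \<open>?S \<subseteq> \<Omega>\<close> Ck show ?thesis unfolding test_functions_def by blast
qed

lemma Xgrad_compose:
  assumes "w differentiable (at x)" "(h has_real_derivative d) (at (w x))"
  shows "Xgrad c (\<lambda>x. h (w x)) x = d *\<^sub>R Xgrad c w x"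
proof -
  have "partial_deriv i (\<lambda>x. h (w x)) x = partial_deriv i w x * d" for i
    using assms(1)
    by (subst partial_deriv_eq[OF DERIV_compose_FDERIV[where g = w, OF assms(2)]])
      (auto simp: partial_deriv_def frechet_derivative_works)
  then show ?thesis by (simp add: Xgrad_def vec_eq_iff sum_distrib_left mult_ac)
qed

lemma Xgrad_scaled_diff:
  assumes "v differentiable (at x)" "w differentiable (at x)"
  shows "Xgrad c (\<lambda>x. a * (v x - w x)) x = a *\<^sub>R (Xgrad c v x - Xgrad c w x)"
proof -
  have "partial_deriv i (\<lambda>x. a * (v x - w x)) x = a * (partial_deriv i v x - partial_deriv i w x)" for i
    using assms
    by (subst partial_deriv_eq[OF has_derivative_mult_right[OF has_derivative_diff]])
      (auto simp: partial_deriv_def frechet_derivative_works)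
  then have "Xgrad c (\<lambda>x. a * (v x - w x)) x
      = (\<chi> j. \<Sum>k\<in>UNIV. c x $ j $ k * (a * (partial_deriv k v x - partial_deriv k w x)))"
    by (simp only: Xgrad_def)
  then show ?thesis by (simp add: Xgrad_def vec_eq_iff sum_distrib_left sum_subtractf algebra_simps)
qed

section \<open>The space \<open>W\<^sub>0\<close>\<close>

lemma W0_gradE:
  assumes "W0_grad c \<Omega> p u G"
  obtains \<phi> where "\<And>n. \<phi> n \<in> test_functions \<Omega>" "Lp_converges \<Omega> p \<phi> u"
    "Lp_converges \<Omega> p (\<lambda>n. Xgrad c (\<phi> n)) G"
  using assms unfolding W0_grad_def by blast

lemma W0_grad_in_Lp: "W0_grad c \<Omega> p u G \<Longrightarrow> in_Lp \<Omega> p u \<and> in_Lp \<Omega> p G"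
  by (auto simp: W0_grad_def Lp_converges_def)

lemma W0_grad_lower_exponent:
  assumes "finite_measure (lebesgue_on \<Omega>)" "W0_grad c \<Omega> p u G" "0 < q" "q \<le> p"
  shows "W0_grad c \<Omega> q u G"
  using assms unfolding W0_grad_def by (meson Lp_converges_lower_exponent)

lemma W0_grad_scaled_diff:
  assumes "W0_grad c \<Omega> p u G" "W0_grad c \<Omega> p v H" "p > 0"
  shows "W0_grad c \<Omega> p (\<lambda>x. a * (u x - v x)) (\<lambda>x. a *\<^sub>R (G x - H x))"
proof -
  obtain \<phi> where \<phi>: "\<And>n. \<phi> n \<in> test_functions \<Omega>" "Lp_converges \<Omega> p \<phi> u"
    "Lp_converges \<Omega> p (\<lambda>n. Xgrad c (\<phi> n)) G" using W0_gradE[OF assms(1)] by blast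
  obtain \<psi> where \<psi>: "\<And>n. \<psi> n \<in> test_functions \<Omega>" "Lp_converges \<Omega> p \<psi> v"
    "Lp_converges \<Omega> p (\<lambda>n. Xgrad c (\<psi> n)) H" using W0_gradE[OF assms(2)] by blast
  have "Xgrad c (\<lambda>x. a * (\<phi> n x - \<psi> n x)) = (\<lambda>x. a *\<^sub>R (Xgrad c (\<phi> n) x - Xgrad c (\<psi> n) x))" for n
    by (rule ext, rule Xgrad_scaled_diff) (use \<phi> \<psi> test_functions_differentiable in blast)+
  then show ?thesis
    using test_functions_scaled_diff[OF \<phi>(1) \<psi>(1)]
      Lp_converges_diff[OF \<phi>(2) \<psi>(2) assms(3), of a] Lp_converges_diff[OF \<phi>(3) \<psi>(3) assms(3), of a]
    unfolding W0_grad_def by (intro exI[of _ "\<lambda>n x. a * (\<phi> n x - \<psi> n x)"]) simp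
qed

text \<open>For each \<open>n\<close> a test function is selected that is close to \<open>us n\<close> together with its \<open>X\<close>-gradient; the selected sequence and
  its gradients have the limits \<open>u\<close> and \<open>G\<close>.\<close>

lemma W0_grad_closed:
  assumes p: "p > 0" and W: "\<And>n. W0_grad c \<Omega> p (us n) (Gs n)"
    and us: "Lp_converges \<Omega> p us u" and Gs: "Lp_converges \<Omega> p Gs G"
  shows "W0_grad c \<Omega> p u G"
proof -
  have "\<forall>n. \<exists>\<phi>. \<phi> \<in> test_functions \<Omega> \<and> in_Lp \<Omega> p \<phi> \<and> in_Lp \<Omega> p (Xgrad c \<phi>) \<and>
     (LINT x|lebesgue_on \<Omega>. norm (\<phi> x - us n x) powr p) < inverse (real (Suc n)) \<and>
     (LINT x|lebesgue_on \<Omega>. norm (Xgrad c \<phi> x - Gs n x) powr p) < inverse (real (Suc n))"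
  proof
    fix n
    obtain \<phi> where \<phi>: "\<And>k. \<phi> k \<in> test_functions \<Omega>" "Lp_converges \<Omega> p \<phi> (us n)"
      "Lp_converges \<Omega> p (\<lambda>k. Xgrad c (\<phi> k)) (Gs n)" using W0_gradE[OF W[of n]] by blast
    have "(\<lambda>k. LINT x|lebesgue_on \<Omega>. norm (\<phi> k x - us n x) powr p) \<longlonglongrightarrow> 0"
      "(\<lambda>k. LINT x|lebesgue_on \<Omega>. norm (Xgrad c (\<phi> k) x - Gs n x) powr p) \<longlonglongrightarrow> 0"
      using \<phi> p by (simp_all add: Lp_converges_iff)
    then have "\<forall>\<^sub>F k in sequentially. (LINT x|lebesgue_on \<Omega>. norm (\<phi> k x - us n x) powr p) < inverse (real (Suc n)) \<and>
      (LINT x|lebesgue_on \<Omega>. norm (Xgrad c (\<phi> k) x - Gs n x) powr p) < inverse (real (Suc n))"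
      by (intro eventually_conj order_tendstoD(2)) auto
    then obtain k where "(LINT x|lebesgue_on \<Omega>. norm (\<phi> k x - us n x) powr p) < inverse (real (Suc n)) \<and>
      (LINT x|lebesgue_on \<Omega>. norm (Xgrad c (\<phi> k) x - Gs n x) powr p) < inverse (real (Suc n))"
      using eventually_happens'[OF sequentially_bot] by blast
    then show "\<exists>\<phi>. \<phi> \<in> test_functions \<Omega> \<and> in_Lp \<Omega> p \<phi> \<and> in_Lp \<Omega> p (Xgrad c \<phi>) \<and>
     (LINT x|lebesgue_on \<Omega>. norm (\<phi> x - us n x) powr p) < inverse (real (Suc n)) \<and>
     (LINT x|lebesgue_on \<Omega>. norm (Xgrad c \<phi> x - Gs n x) powr p) < inverse (real (Suc n))"
      using \<phi> by (intro exI[of _ "\<phi> k"]) (auto simp: Lp_converges_def)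
  qed
  from choice[OF this]
  obtain \<phi> where \<phi>: "\<And>n. \<phi> n \<in> test_functions \<Omega>" "\<And>n. in_Lp \<Omega> p (\<phi> n)" "\<And>n. in_Lp \<Omega> p (Xgrad c (\<phi> n))"
     "\<And>n. (LINT x|lebesgue_on \<Omega>. norm (\<phi> n x - us n x) powr p) < inverse (real (Suc n))"
     "\<And>n. (LINT x|lebesgue_on \<Omega>. norm (Xgrad c (\<phi> n) x - Gs n x) powr p) < inverse (real (Suc n))"
    by blast
  have transfer: "Lp_converges \<Omega> p gs g"
    if "\<And>n. in_Lp \<Omega> p (gs n)" "Lp_converges \<Omega> p fs g"
      "\<And>n. (LINT x|lebesgue_on \<Omega>. norm (gs n x - fs n x) powr p) < inverse (real (Suc n))"
    for fs gs :: "nat \<Rightarrow> real ^ 'a \<Rightarrow> 'c::euclidean_space" and g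
  proof -
    have in_Lp: "in_Lp \<Omega> p (fs n)" "in_Lp \<Omega> p g" for n
      using that(2) by (auto simp: Lp_converges_def)
    have lim: "(\<lambda>n. LINT x|lebesgue_on \<Omega>. norm (fs n x - g x) powr p) \<longlonglongrightarrow> 0"
      using that(2) p by (simp add: Lp_converges_iff)
    have "(\<lambda>n. LINT x|lebesgue_on \<Omega>. norm (gs n x - g x) powr p) \<longlonglongrightarrow> 0"
    proof (rule tendsto_0_nonneg_le)
      show "(LINT x|lebesgue_on \<Omega>. norm (gs n x - g x) powr p)
        \<le> 2 powr p * (inverse (real (Suc n)) + (LINT x|lebesgue_on \<Omega>. norm (fs n x - g x) powr p))" for n
      proof -
        have "2 powr p * ((LINT x|lebesgue_on \<Omega>. norm (gs n x - fs n x) powr p) + (LINT x|lebesgue_on \<Omega>. norm (fs n x - g x) powr p))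
          \<le> 2 powr p * (inverse (real (Suc n)) + (LINT x|lebesgue_on \<Omega>. norm (fs n x - g x) powr p))"
          using that(3)[of n] by (intro mult_left_mono add_right_mono) auto
        then show ?thesis
          using integral_norm_diff_powr_le[OF that(1) in_Lp p, of n n] by linarith
      qed
      show "(\<lambda>n. 2 powr p * (inverse (real (Suc n)) + (LINT x|lebesgue_on \<Omega>. norm (fs n x - g x) powr p))) \<longlonglongrightarrow> 0"
        using tendsto_mult[OF tendsto_const tendsto_add[OF LIMSEQ_inverse_real_of_nat lim], of "2 powr p"]
        by simp
    qed simp
    then show ?thesis using that(1) in_Lp p by (simp add: Lp_converges_iff)
  qed
  show ?thesis unfolding W0_grad_def
    using \<phi>(1) transfer[OF \<phi>(2) us \<phi>(4)] transfer[OF \<phi>(3) Gs \<phi>(5)] by blast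
qed

text \<open>Along a subsequence the test functions converge almost everywhere, and then
  \<open>h'(\<phi>\<^sub>n) X\<phi>\<^sub>n - h'(u) G = h'(\<phi>\<^sub>n) (X\<phi>\<^sub>n - G) + (h'(\<phi>\<^sub>n) - h'(u)) G\<close>
  tends to \<open>0\<close>: the second term is dominated by \<open>2 |G|\<close>.\<close>

lemma W0_grad_chain:
  assumes fin: "finite_measure (lebesgue_on \<Omega>)" and p: "1 \<le> p" and W: "W0_grad c \<Omega> p u G"
    and test: "\<And>w. w \<in> test_functions \<Omega> \<Longrightarrow> (\<lambda>x. h (w x)) \<in> test_functions \<Omega>"
    and h: "\<And>t. (h has_real_derivative h' t) (at t)" "\<And>t. \<bar>h' t\<bar> \<le> 1" "continuous_on UNIV h'" "h 0 = 0"
  shows "W0_grad c \<Omega> p (\<lambda>x. h (u x)) (\<lambda>x. h' (u x) *\<^sub>R G x)"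
proof -
  let ?M = "lebesgue_on \<Omega>"
  have p0: "p > 0" using p by simp
  have lip: "\<bar>h s - h t\<bar> \<le> \<bar>s - t\<bar>" for s t
    using field_differentiable_bound[of UNIV h h' 1 s t] h by simp
  have h_le: "\<bar>h t\<bar> \<le> \<bar>t\<bar>" for t using lip[of t 0] h(4) by simp
  have [measurable]: "h' \<in> borel_measurable borel"
    by (rule borel_measurable_continuous_onI[OF h(3)])
  have [measurable]: "h \<in> borel_measurable borel"
    by (rule borel_measurable_continuous_onI) (use h(1) DERIV_isCont continuous_at_imp_continuous_on in blast)
  obtain \<phi>0 where \<phi>0: "\<And>n. \<phi>0 n \<in> test_functions \<Omega>" "Lp_converges \<Omega> p \<phi>0 u"
    "Lp_converges \<Omega> p (\<lambda>n. Xgrad c (\<phi>0 n)) G" using W0_gradE[OF W] by blast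
  obtain r where r: "strict_mono r" and AE0: "AE x in ?M. (\<lambda>n. \<phi>0 (r n) x) \<longlonglongrightarrow> u x"
    using Lp_converges_AE_subseq[OF fin \<phi>0(2) p] by blast
  define \<phi> where "\<phi> n = \<phi>0 (r n)" for n
  have \<phi>: "\<And>n. \<phi> n \<in> test_functions \<Omega>" "Lp_converges \<Omega> p \<phi> u"
    "Lp_converges \<Omega> p (\<lambda>n. Xgrad c (\<phi> n)) G" and AE: "AE x in ?M. (\<lambda>n. \<phi> n x) \<longlonglongrightarrow> u x"
    using \<phi>0 AE0 Lp_converges_subseq[OF \<phi>0(2) r] Lp_converges_subseq[OF \<phi>0(3) r]
    by (auto simp: \<phi>_def[abs_def])
  have in_Lp: "in_Lp \<Omega> p (\<phi> n)" "in_Lp \<Omega> p u" "in_Lp \<Omega> p (Xgrad c (\<phi> n))" "in_Lp \<Omega> p G" for n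
    using \<phi> by (auto simp: Lp_converges_def)
  then have [measurable]: "\<phi> n \<in> borel_measurable ?M" "u \<in> borel_measurable ?M"
    "Xgrad c (\<phi> n) \<in> borel_measurable ?M" "G \<in> borel_measurable ?M" for n
    by (auto simp: in_Lp_def)
  have lim: "(\<lambda>n. LINT x|?M. norm (\<phi> n x - u x) powr p) \<longlonglongrightarrow> 0"
    "(\<lambda>n. LINT x|?M. norm (Xgrad c (\<phi> n) x - G x) powr p) \<longlonglongrightarrow> 0"
    using \<phi> p0 by (simp_all add: Lp_converges_iff)
  have Xh: "Xgrad c (\<lambda>x. h (\<phi> n x)) = (\<lambda>x. h' (\<phi> n x) *\<^sub>R Xgrad c (\<phi> n) x)" for n
    by (rule ext, rule Xgrad_compose[OF test_functions_differentiable[OF \<phi>(1)] h(1)])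
  have scaled: "norm (h' s *\<^sub>R z) \<le> 1 * norm z" for s and z :: "real ^ 'b"
    using mult_right_mono[OF h(2)[of s], of "norm z"] by simp
  have in_h: "in_Lp \<Omega> p (\<lambda>x. h (\<phi> n x))" "in_Lp \<Omega> p (\<lambda>x. h (u x))" for n
    by (rule in_LpI_bound[OF in_Lp(1)[of n] _ p0, where K = 1], measurable, use h_le in simp)
      (rule in_LpI_bound[OF in_Lp(2) _ p0, where K = 1], measurable, use h_le in simp)
  have in_X: "in_Lp \<Omega> p (\<lambda>x. h' (\<phi> n x) *\<^sub>R Xgrad c (\<phi> n) x)" "in_Lp \<Omega> p (\<lambda>x. h' (\<phi> n x) *\<^sub>R G x)"
    "in_Lp \<Omega> p (\<lambda>x. h' (u x) *\<^sub>R G x)" for n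
    by (rule in_LpI_bound[OF in_Lp(3)[of n] _ p0 scaled], measurable)
      (rule in_LpI_bound[OF in_Lp(4) _ p0 scaled], measurable)+
  have "(\<lambda>n. LINT x|?M. norm (h (\<phi> n x) - h (u x)) powr p) \<longlonglongrightarrow> 0"
  proof (rule tendsto_0_nonneg_le[OF _ _ lim(1)])
    fix n
    show "(LINT x|?M. norm (h (\<phi> n x) - h (u x)) powr p) \<le> (LINT x|?M. norm (\<phi> n x - u x) powr p)"
      using in_Lp_diff[OF in_h(1)[of n] in_h(2) p0] in_Lp_diff[OF in_Lp(1)[of n] in_Lp(2) p0] lip p0
      by (intro integral_mono powr_mono2) (auto simp: in_Lp_def)
  qed simp
  then have 1: "Lp_converges \<Omega> p (\<lambda>n x. h (\<phi> n x)) (\<lambda>x. h (u x))"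
    using in_h p0 by (simp add: Lp_converges_iff)
  have dom: "(\<lambda>n. LINT x|?M. norm (h' (\<phi> n x) *\<^sub>R G x - h' (u x) *\<^sub>R G x) powr p) \<longlonglongrightarrow> (LINT x|?M. 0)"
  proof (rule integral_dominated_convergence[where w = "\<lambda>x. 2 powr p * norm (G x) powr p"])
    show "AE x in ?M. (\<lambda>n. norm (h' (\<phi> n x) *\<^sub>R G x - h' (u x) *\<^sub>R G x) powr p) \<longlonglongrightarrow> 0"
      using AE
    proof eventually_elim
      case (elim x)
      have "isCont h' (u x)" using h(3) by (simp add: continuous_on_eq_continuous_at)
      then have "(\<lambda>n. h' (\<phi> n x)) \<longlonglongrightarrow> h' (u x)" using elim by (rule isCont_tendsto_compose)
      then have "(\<lambda>n. norm (h' (\<phi> n x) *\<^sub>R G x - h' (u x) *\<^sub>R G x) powr p)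
         \<longlonglongrightarrow> norm (h' (u x) *\<^sub>R G x - h' (u x) *\<^sub>R G x) powr p"
        using p0 by (intro tendsto_powr' tendsto_norm tendsto_diff tendsto_scaleR tendsto_const) auto
      then show ?case by simp
    qed
    show "AE x in ?M. norm (norm (h' (\<phi> n x) *\<^sub>R G x - h' (u x) *\<^sub>R G x) powr p) \<le> 2 powr p * norm (G x) powr p" for n
    proof (rule AE_I2)
      fix x
      have "norm (h' (\<phi> n x) *\<^sub>R G x - h' (u x) *\<^sub>R G x) \<le> 2 * norm (G x)"
        using norm_triangle_ineq4[of "h' (\<phi> n x) *\<^sub>R G x" "h' (u x) *\<^sub>R G x"]
          scaled[of "\<phi> n x" "G x"] scaled[of "u x" "G x"] by linarith
      then have "norm (h' (\<phi> n x) *\<^sub>R G x - h' (u x) *\<^sub>R G x) powr p \<le> (2 * norm (G x)) powr p"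
        using p0 by (intro powr_mono2) auto
      then show "norm (norm (h' (\<phi> n x) *\<^sub>R G x - h' (u x) *\<^sub>R G x) powr p) \<le> 2 powr p * norm (G x) powr p"
        by (simp add: powr_mult)
    qed
    show "integrable ?M (\<lambda>x. 2 powr p * norm (G x) powr p)"
      using in_Lp(4) by (simp add: in_Lp_def)
  qed measurable
  have "(\<lambda>n. LINT x|?M. norm (h' (\<phi> n x) *\<^sub>R Xgrad c (\<phi> n) x - h' (u x) *\<^sub>R G x) powr p) \<longlonglongrightarrow> 0"
  proof (rule tendsto_0_nonneg_le)
    fix n
    have "(LINT x|?M. norm (h' (\<phi> n x) *\<^sub>R Xgrad c (\<phi> n) x - h' (\<phi> n x) *\<^sub>R G x) powr p)
       \<le> (LINT x|?M. norm (Xgrad c (\<phi> n) x - G x) powr p)"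
      using in_Lp_diff[OF in_X(1)[of n] in_X(2)[of n] p0] in_Lp_diff[OF in_Lp(3)[of n] in_Lp(4) p0] p0
        scaled[of "\<phi> n x" "Xgrad c (\<phi> n) x - G x" for x]
      by (intro integral_mono powr_mono2) (auto simp: in_Lp_def simp flip: scaleR_diff_right)
    then have "2 powr p * ((LINT x|?M. norm (h' (\<phi> n x) *\<^sub>R Xgrad c (\<phi> n) x - h' (\<phi> n x) *\<^sub>R G x) powr p)
          + (LINT x|?M. norm (h' (\<phi> n x) *\<^sub>R G x - h' (u x) *\<^sub>R G x) powr p))
       \<le> 2 powr p * ((LINT x|?M. norm (Xgrad c (\<phi> n) x - G x) powr p)
          + (LINT x|?M. norm (h' (\<phi> n x) *\<^sub>R G x - h' (u x) *\<^sub>R G x) powr p))"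
      by (intro mult_left_mono add_right_mono) auto
    then show "(LINT x|?M. norm (h' (\<phi> n x) *\<^sub>R Xgrad c (\<phi> n) x - h' (u x) *\<^sub>R G x) powr p)
       \<le> 2 powr p * ((LINT x|?M. norm (Xgrad c (\<phi> n) x - G x) powr p)
          + (LINT x|?M. norm (h' (\<phi> n x) *\<^sub>R G x - h' (u x) *\<^sub>R G x) powr p))"
      using integral_norm_diff_powr_le[OF in_X(1)[of n] in_X(2)[of n] in_X(3) p0] by linarith
  next
    show "(\<lambda>n. 2 powr p * ((LINT x|?M. norm (Xgrad c (\<phi> n) x - G x) powr p)
          + (LINT x|?M. norm (h' (\<phi> n x) *\<^sub>R G x - h' (u x) *\<^sub>R G x) powr p))) \<longlonglongrightarrow> 0"
      using tendsto_mult[OF tendsto_const tendsto_add[OF lim(2) dom], of "2 powr p"] by simp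
  qed simp
  then have "Lp_converges \<Omega> p (\<lambda>n x. h' (\<phi> n x) *\<^sub>R Xgrad c (\<phi> n) x) (\<lambda>x. h' (u x) *\<^sub>R G x)"
    using in_X p0 by (simp add: Lp_converges_iff)
  with 1 show ?thesis
    unfolding W0_grad_def using \<phi>(1) test
    by (intro exI[of _ "\<lambda>n x. h (\<phi> n x)"]) (simp add: Xh)
qed

section \<open>Smooth sublinear powers\<close>

text \<open>At infinity \<open>damp b t\<close> behaves like \<open>|t|\<^bsup>1 + 2b\<^esup> sgn t\<close>, and it is smooth and vanishes at \<open>0\<close>, so that
  it preserves test functions. For \<open>- 1/2 \<le> b \<le> 0\<close> it is nondecreasing and \<open>1\<close>-Lipschitz.\<close>

definition damp :: "real \<Rightarrow> real \<Rightarrow> real" where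
  "damp b t = t * (1 + t\<^sup>2) powr b"

definition damp_deriv :: "real \<Rightarrow> real \<Rightarrow> real" where
  "damp_deriv b t = (1 + (1 + 2 * b) * t\<^sup>2) * (1 + t\<^sup>2) powr (b - 1)"

lemma one_plus_square_pos: "0 < 1 + (t::real)\<^sup>2"
  by (simp add: add_pos_nonneg)

lemma DERIV_damp: "(damp b has_real_derivative damp_deriv b t) (at t)"
proof -
  have "poly (pderiv [:0, 1:] * [:1, 0, 1:] + smult (2 * b) ([:0, 1:] * [:0, 1:])) t * (1 + t\<^sup>2) powr (b - 1)
    = damp_deriv b t"
    by (simp add: damp_deriv_def pderiv_pCons algebra_simps power2_eq_square)
  with DERIV_poly_powr[of "[:0, 1:]" b t] show ?thesis by (simp add: damp_def[abs_def])
qed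

lemma continuous_damp_deriv: "continuous_on UNIV (damp_deriv b)"
proof -
  have "1 + t\<^sup>2 \<noteq> 0" for t :: real using one_plus_square_pos[of t] by linarith
  then show ?thesis unfolding damp_deriv_def[abs_def] by (intro continuous_intros) auto
qed

lemma damp_deriv_bounds:
  assumes "- 1 / 2 \<le> b" "b \<le> 0"
  shows "0 \<le> damp_deriv b t" "(1 + 2 * b) * (1 + t\<^sup>2) powr b \<le> damp_deriv b t"
    "damp_deriv b t \<le> (1 + t\<^sup>2) powr b" "(1 + t\<^sup>2) powr b \<le> 1"
proof -
  have eq: "(1 + t\<^sup>2) powr b = (1 + t\<^sup>2) * (1 + t\<^sup>2) powr (b - 1)"
    using one_plus_square_pos[of t] by (simp add: powr_diff)
  have le: "(1 + 2 * b) * (1 + t\<^sup>2) \<le> 1 + (1 + 2 * b) * t\<^sup>2" "1 + (1 + 2 * b) * t\<^sup>2 \<le> 1 + t\<^sup>2"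
    using assms mult_right_mono[of "1 + 2 * b" 1 "t\<^sup>2"] by (auto simp: algebra_simps)
  show "0 \<le> damp_deriv b t" unfolding damp_deriv_def
    using assms mult_nonneg_nonneg[of "1 + 2 * b" "t\<^sup>2"] by (intro mult_nonneg_nonneg) auto
  show "(1 + 2 * b) * (1 + t\<^sup>2) powr b \<le> damp_deriv b t"
    unfolding eq damp_deriv_def mult.assoc[symmetric] by (intro mult_right_mono le) auto
  show "damp_deriv b t \<le> (1 + t\<^sup>2) powr b"
    unfolding eq damp_deriv_def by (intro mult_right_mono le) auto
  have "(1 + t\<^sup>2) powr b \<le> 1 powr b"
    using assms by (intro powr_mono2') auto
  then show "(1 + t\<^sup>2) powr b \<le> 1" by (simp only: powr_one_eq_one)
qed

lemma abs_damp_le: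
  assumes "b \<le> 0"
  shows "\<bar>damp b t\<bar> \<le> \<bar>t\<bar> powr (1 + 2 * b)"
proof (cases "t = 0")
  case False
  have sq: "(t\<^sup>2) powr b = \<bar>t\<bar> powr (2 * b)"
    using powr_powr[of "\<bar>t\<bar>" 2 b] by simp
  have "(1 + t\<^sup>2) powr b \<le> (t\<^sup>2) powr b"
    using assms False by (intro powr_mono2') auto
  also have "\<dots> = \<bar>t\<bar> powr (2 * b)" by (rule sq)
  finally have "\<bar>t\<bar> * (1 + t\<^sup>2) powr b \<le> \<bar>t\<bar> * \<bar>t\<bar> powr (2 * b)"
    by (intro mult_left_mono) auto
  also have "\<dots> = \<bar>t\<bar> powr (1 + 2 * b)" using False by (simp add: powr_add)
  finally show ?thesis by (simp add: damp_def abs_mult)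
qed (simp add: damp_def)

text \<open>For \<open>|t| \<ge> 1\<close> one has \<open>1 + t\<^sup>2 \<le> 2 t\<^sup>2\<close>; this is the source of the power of \<open>2\<close>.\<close>

lemma powr_le_damp:
  assumes "- 1 / 2 \<le> b" "b \<le> 0" "e \<ge> 0"
  shows "\<bar>t\<bar> powr ((1 + 2 * b) * e) \<le> 1 + 2 powr (- b * e) * \<bar>damp b t\<bar> powr e"
proof (cases "\<bar>t\<bar> \<le> 1")
  case True
  have "\<bar>t\<bar> powr ((1 + 2 * b) * e) \<le> 1 powr ((1 + 2 * b) * e)"
    using assms True by (intro powr_mono2 mult_nonneg_nonneg) auto
  then show ?thesis by (simp add: add_increasing2)
next
  case False
  have sq: "(t\<^sup>2) powr b = \<bar>t\<bar> powr (2 * b)"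
    using powr_powr[of "\<bar>t\<bar>" 2 b] by simp
  have "1 \<le> t\<^sup>2" using False abs_le_square_iff[of 1 t] by simp
  then have "(2 * t\<^sup>2) powr b \<le> (1 + t\<^sup>2) powr b"
    using assms by (intro powr_mono2') (auto simp: add_pos_nonneg)
  then have le: "2 powr b * \<bar>t\<bar> powr (2 * b) \<le> (1 + t\<^sup>2) powr b"
    by (simp add: powr_mult sq)
  have "\<bar>t\<bar> powr (1 + 2 * b) = 2 powr (- b) * (\<bar>t\<bar> * (2 powr b * \<bar>t\<bar> powr (2 * b)))"
    using False by (simp add: powr_add powr_minus)
  also have "\<dots> \<le> 2 powr (- b) * (\<bar>t\<bar> * (1 + t\<^sup>2) powr b)"
    by (intro mult_left_mono le) auto
  also have "\<dots> = 2 powr (- b) * \<bar>damp b t\<bar>" by (simp add: damp_def abs_mult)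
  finally have "(\<bar>t\<bar> powr (1 + 2 * b)) powr e \<le> (2 powr (- b) * \<bar>damp b t\<bar>) powr e"
    using assms by (intro powr_mono2) auto
  then show ?thesis by (simp add: powr_powr powr_mult)
qed

lemma W0_grad_damp:
  assumes "finite_measure (lebesgue_on \<Omega>)" "1 \<le> p" "W0_grad c \<Omega> p u G" "- 1 / 2 \<le> b" "b \<le> 0"
  shows "W0_grad c \<Omega> p (\<lambda>x. damp b (u x)) (\<lambda>x. damp_deriv b (u x) *\<^sub>R G x)"
proof (rule W0_grad_chain[OF assms(1-3)])
  fix w :: "real ^ 'a \<Rightarrow> real" assume w: "w \<in> test_functions \<Omega>"
  have "Ck k (\<lambda>x. damp b (w x))" for k
    using Ck_poly_powr_compose[of k w "[:0, 1:]" b] w by (simp add: test_functions_def damp_def)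
  then show "(\<lambda>x. damp b (w x)) \<in> test_functions \<Omega>"
    by (rule test_functions_compose[OF w, where h = "damp b"]) (simp add: damp_def)
next
  show "\<bar>damp_deriv b t\<bar> \<le> 1" for t
    using damp_deriv_bounds[OF assms(4,5), of t] by linarith
  show "(damp b has_real_derivative damp_deriv b t) (at t)" for t by (rule DERIV_damp)
  show "continuous_on UNIV (damp_deriv b)" by (rule continuous_damp_deriv)
  show "damp b 0 = 0" by (simp add: damp_def)
qed

section \<open>A normalised Hoelder inequality and absorption\<close>

text \<open>Young's inequality for \<open>|h|\<close> and \<open>|F| / k\<close>, where \<open>k = Z\<^bsup>1/p'\<^esup>\<close> is chosen so that both integrals on its
  right-hand side are at most \<open>1\<close>. The factor \<open>2\<close> comes from discarding the weights \<open>1/p\<close> and \<open>1/p'\<close>.\<close>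

lemma integral_mult_le_Holder:
  assumes p: "1 < p" and h: "in_Lp \<Omega> p h" "(LINT x|lebesgue_on \<Omega>. \<bar>h x\<bar> powr p) \<le> 1"
    and F: "in_Lp \<Omega> (p / (p - 1)) F" "(LINT x|lebesgue_on \<Omega>. \<bar>F x\<bar> powr (p / (p - 1))) \<le> Z" and Z: "0 < Z"
  shows "(LINT x|lebesgue_on \<Omega>. h x * F x) \<le> 2 * Z powr ((p - 1) / p)"
proof -
  let ?M = "lebesgue_on \<Omega>" and ?p' = "p / (p - 1)"
  have p': "1 < ?p'" "1 / p + 1 / ?p' = 1" using p by (auto simp: field_simps)
  define k where "k = Z powr ((p - 1) / p)"
  have k: "0 < k" "k powr ?p' = Z" using Z p by (auto simp: k_def powr_powr)
  have [measurable]: "h \<in> borel_measurable ?M" "F \<in> borel_measurable ?M"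
    using h F by (auto simp: in_Lp_def)
  have i: "integrable ?M (\<lambda>x. \<bar>h x\<bar> powr p)" "integrable ?M (\<lambda>x. \<bar>F x\<bar> powr ?p')"
    using h F by (auto simp: in_Lp_def)
  then have int: "integrable ?M (\<lambda>x. k * (\<bar>h x\<bar> powr p + \<bar>F x\<bar> powr ?p' / Z))" by auto
  have le: "\<bar>h x * F x\<bar> \<le> k * (\<bar>h x\<bar> powr p + \<bar>F x\<bar> powr ?p' / Z)" for x
  proof -
    have "\<bar>h x\<bar> * (\<bar>F x\<bar> / k) \<le> \<bar>h x\<bar> powr p / p + (\<bar>F x\<bar> / k) powr ?p' / ?p'"
      using k by (intro Youngs_inequality p p') auto
    also have "\<dots> \<le> \<bar>h x\<bar> powr p + (\<bar>F x\<bar> / k) powr ?p'"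
      using p p' divide_left_mono[of 1 p "\<bar>h x\<bar> powr p"]
        divide_left_mono[of 1 ?p' "(\<bar>F x\<bar> / k) powr ?p'"] by (intro add_mono) simp_all
    also have "(\<bar>F x\<bar> / k) powr ?p' = \<bar>F x\<bar> powr ?p' / Z"
      using k by (simp add: powr_divide)
    finally have "k * (\<bar>h x\<bar> * (\<bar>F x\<bar> / k)) \<le> k * (\<bar>h x\<bar> powr p + \<bar>F x\<bar> powr ?p' / Z)"
      using k by (intro mult_left_mono) auto
    then show ?thesis using k by (simp add: abs_mult)
  qed
  have "integrable ?M (\<lambda>x. h x * F x)"
  proof (rule Bochner_Integration.integrable_bound[OF int])
    show "AE x in ?M. norm (h x * F x) \<le> norm (k * (\<bar>h x\<bar> powr p + \<bar>F x\<bar> powr ?p' / Z))"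
      unfolding real_norm_def by (intro AE_I2 order_trans[OF le abs_ge_self])
  qed measurable
  then have "(LINT x|?M. h x * F x) \<le> (LINT x|?M. k * (\<bar>h x\<bar> powr p + \<bar>F x\<bar> powr ?p' / Z))"
    using int le by (intro integral_mono) (auto intro: order_trans[OF abs_ge_self])
  also have "\<dots> = k * ((LINT x|?M. \<bar>h x\<bar> powr p) + (LINT x|?M. \<bar>F x\<bar> powr ?p') / Z)"
    using i by simp
  also have "\<dots> \<le> k * (1 + 1)"
    using k Z h(2) F(2) by (intro mult_left_mono add_mono) auto
  finally show ?thesis by (simp add: k_def)
qed

text \<open>For \<open>E \<ge> 1\<close> the hypothesis becomes \<open>E \<le> C 2\<^sup>f E\<^bsup>e f\<^esup>\<close> with \<open>e f < 1\<close>.\<close>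

lemma absorb_sublinear_power:
  fixes E :: real
  assumes "0 \<le> C" "0 < e" "0 < f" "e * f < 1" and le: "E \<le> C * (1 + E powr e) powr f"
  shows "E \<le> max 1 ((C * 2 powr f) powr (1 / (1 - e * f)))"
proof (cases "E \<le> 1")
  case False
  then have E: "1 < E" by simp
  have "1 + E powr e \<le> 2 * E powr e" using E assms by (simp add: ge_one_powr_ge_zero)
  then have "(1 + E powr e) powr f \<le> (2 * E powr e) powr f"
    using assms by (intro powr_mono2) auto
  then have "C * (1 + E powr e) powr f \<le> C * (2 * E powr e) powr f"
    using assms by (intro mult_left_mono)
  also have "\<dots> = C * 2 powr f * E powr (e * f)" by (simp add: powr_mult powr_powr)
  finally have "E \<le> C * 2 powr f * E powr (e * f)" using le by linarith
  then have "E powr (1 - e * f) \<le> C * 2 powr f"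
    using E by (simp add: powr_diff divide_le_eq)
  then have "(E powr (1 - e * f)) powr (1 / (1 - e * f)) \<le> (C * 2 powr f) powr (1 / (1 - e * f))"
    using assms by (intro powr_mono2) auto
  then show ?thesis using E assms by (simp add: powr_powr)
qed simp

section \<open>The gradient estimate\<close>

text \<open>The Lebesgue integral of a function that is not integrable is \<open>0\<close> by convention, so monotonicity and
  additivity of the bilinear form depend on this fact.\<close>

lemma integrable_matrix_form:
  fixes A :: "real ^ 'n::finite \<Rightarrow> real ^ 'm ^ 'm::finite"
  assumes A: "admissible_matrix \<Omega> A \<alpha> \<beta>" and G: "in_Lp \<Omega> 2 G" and H: "in_Lp \<Omega> 2 H"
  shows "integrable (lebesgue_on \<Omega>) (\<lambda>x. (A x *v G x) \<bullet> H x)"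
proof -
  let ?M = "lebesgue_on \<Omega>"
  have meas: "A \<in> borel_measurable ?M" "G \<in> borel_measurable ?M" "H \<in> borel_measurable ?M"
    using assms by (auto simp: admissible_matrix_def in_Lp_def)
  obtain M where M: "\<And>x i j. x \<in> \<Omega> \<Longrightarrow> \<bar>A x $ i $ j\<bar> \<le> M"
    using A by (auto simp: admissible_matrix_def)
  have [measurable]: "(\<lambda>x. A x $ i $ j) \<in> borel_measurable ?M" "(\<lambda>x. G x $ i) \<in> borel_measurable ?M"
    "(\<lambda>x. H x $ i) \<in> borel_measurable ?M" for i j
    by (rule measurable_compose[OF meas(1)] measurable_compose[OF meas(2)] measurable_compose[OF meas(3)],
        intro borel_measurable_continuous_onI continuous_intros)+
  have eq: "(A x *v G x) \<bullet> H x = (\<Sum>i\<in>UNIV. (\<Sum>j\<in>UNIV. A x $ i $ j * G x $ j) * H x $ i)" for x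
    by (simp add: inner_vec_def matrix_vector_mult_def)
  have i: "integrable ?M (\<lambda>x. (\<Sum>i\<in>(UNIV::'m set). \<Sum>j\<in>(UNIV::'m set). M * (norm (G x) powr 2 + norm (H x) powr 2)))"
    using G H by (auto simp: in_Lp_def)
  show ?thesis
  proof (rule Bochner_Integration.integrable_bound[OF i])
    show "(\<lambda>x. (A x *v G x) \<bullet> H x) \<in> borel_measurable ?M" unfolding eq by measurable
    show "AE x in ?M. norm ((A x *v G x) \<bullet> H x)
      \<le> norm (\<Sum>i\<in>(UNIV::'m set). \<Sum>j\<in>(UNIV::'m set). M * (norm (G x) powr 2 + norm (H x) powr 2))"
    proof (rule AE_I2)
      fix x assume "x \<in> space ?M"
      then have x: "x \<in> \<Omega>" by simp
      have "\<bar>(A x *v G x) \<bullet> H x\<bar> \<le> (\<Sum>i\<in>UNIV. \<Sum>j\<in>UNIV. \<bar>A x $ i $ j * G x $ j * H x $ i\<bar>)"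
        unfolding eq sum_distrib_right by (intro order_trans[OF sum_abs] sum_mono sum_abs)
      also have "\<dots> \<le> (\<Sum>i\<in>(UNIV::'m set). \<Sum>j\<in>(UNIV::'m set). M * (norm (G x) powr 2 + norm (H x) powr 2))"
      proof (intro sum_mono)
        fix i j
        have M0: "0 \<le> M" using M[OF x, of i j] by linarith
        have "\<bar>A x $ i $ j * G x $ j * H x $ i\<bar> \<le> M * norm (G x) * norm (H x)"
          unfolding abs_mult
          using M[OF x] M0 component_le_norm_cart[of "G x" j] component_le_norm_cart[of "H x" i]
          by (intro mult_mono) auto
        also have "\<dots> \<le> M * (norm (G x) powr 2 + norm (H x) powr 2)"
        proof -
          have "norm (G x) * norm (H x) \<le> (norm (G x))\<^sup>2 + (norm (H x))\<^sup>2"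
            using sum_squares_bound[of "norm (G x)" "norm (H x)"] mult_nonneg_nonneg[OF norm_ge_zero norm_ge_zero, of "G x" "H x"]
            by linarith
          then show ?thesis using M0 by (simp add: mult_left_mono mult.assoc)
        qed
        finally show "\<bar>A x $ i $ j * G x $ j * H x $ i\<bar> \<le> M * (norm (G x) powr 2 + norm (H x) powr 2)" .
      qed
      finally show "norm ((A x *v G x) \<bullet> H x)
        \<le> norm (\<Sum>i\<in>(UNIV::'m set). \<Sum>j\<in>(UNIV::'m set). M * (norm (G x) powr 2 + norm (H x) powr 2))"
        by simp
    qed
  qed
qed

text \<open>\<open>s\<close> is chosen so that the power of \<open>u\<close> produced by the Sobolev inequality
  for \<open>|u|\<^bsup>(1 + s)/2\<^esup>\<close>, and the one needed to put \<open>|u|\<^sup>s\<close> in \<open>L\<^bsup>p'\<^esup>\<close>, coincide.\<close>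

lemma exponent_relations:
  fixes Q p :: real
  assumes "Q > 2" "1 < p" "p < 2 * Q / (Q + 2)"
  defines "s \<equiv> Q * (p - 1) / (Q - 2 * p)" and "r \<equiv> p * Q / (Q - 2 * p)"
    and "q \<equiv> sobolev_exponent Q p" and "\<sigma> \<equiv> sobolev_exponent Q 2"
  shows "0 < s" "s < 1" "s * (p / (p - 1)) = r" "(1 + s) / 2 * \<sigma> = r" "0 < \<sigma>"
    "\<sigma> / 2 * ((p - 1) / p) < 1" "1 < q" "q < 2" "q \<le> r" "(1 - s) * q = r * (2 - q)"
proof -
  have pQ: "p * (Q + 2) < 2 * Q" using assms by (simp add: pos_less_divide_eq)
  have "0 < (Q - 2) * (Q - 2)" using assms by simp
  then have "4 * (2 * Q) < (Q + 2) * (2 * Q) \<and> 0 < Q + 2" using assms by simp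
  then have "2 * Q / (Q + 2) < Q / 2" by (simp add: divide_simps)
  then have D: "0 < Q - 2 * p" using assms by linarith
  then have D': "0 < Q - p" "0 < Q - 2" "0 < p" using assms by auto
  have D1: "Q - 2 * p \<noteq> 0" "Q - p \<noteq> 0" "Q - 2 \<noteq> 0" "p \<noteq> 0" "p - 1 \<noteq> 0" using D D' assms by auto
  show "0 < s" using D assms by (simp add: s_def)
  show "s < 1" using D pQ by (simp add: s_def divide_less_eq algebra_simps)
  show "s * (p / (p - 1)) = r" using D1 by (simp add: s_def r_def)
  show "(1 + s) / 2 * \<sigma> = r" "0 < \<sigma>"
    using D1 D' by (simp_all add: s_def r_def \<sigma>_def sobolev_exponent_def divide_simps) (simp_all add: algebra_simps)
  show "\<sigma> / 2 * ((p - 1) / p) < 1"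
    using D D' D1 by (simp add: \<sigma>_def sobolev_exponent_def divide_simps) (simp add: algebra_simps)
  have "1 * Q < p * Q" using assms by (intro mult_strict_right_mono) auto
  then have "Q - p < p * Q" using D' by linarith
  then show "1 < q" using D' by (simp add: q_def sobolev_exponent_def less_divide_eq)
  show "q < 2" using D' pQ by (simp add: q_def sobolev_exponent_def divide_less_eq algebra_simps)
  show "q \<le> r" unfolding q_def r_def sobolev_exponent_def
    using D D' by (intro divide_left_mono) auto
  show "(1 - s) * q = r * (2 - q)"
    using D1 by (simp add: s_def r_def q_def sobolev_exponent_def divide_simps) (simp add: algebra_simps)
qed

text \<open>Young's inequality \<open>a\<^sup>\<theta> b\<^bsup>1 - \<theta>\<^esup> \<le> \<theta> a + (1 - \<theta>) b\<close> with \<open>a = g\<^sup>2 (1 + t\<^sup>2)\<^bsup>(s - 1)/2\<^esup>\<close>, \<open>b = (1 + t\<^sup>2)\<^bsup>r/2\<^esup>\<close> and \<open>\<theta> = q/2\<close>: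
  the relation between \<open>s\<close>, \<open>q\<close> and \<open>r\<close> says that the powers of \<open>1 + t\<^sup>2\<close> cancel on the left.\<close>

lemma powr_le_weighted_square:
  fixes g t :: real
  assumes "0 \<le> g" "0 < q" "q < 2" "0 < r" and rel: "(1 - s) * q = r * (2 - q)"
  shows "g powr q \<le> g\<^sup>2 * (1 + t\<^sup>2) powr ((s - 1) / 2) + 2 powr (r / 2) * (1 + \<bar>t\<bar> powr r)"
proof -
  let ?a = "g\<^sup>2 * (1 + t\<^sup>2) powr ((s - 1) / 2)" and ?b = "(1 + t\<^sup>2) powr (r / 2)"
  have b: "?b > 0" using one_plus_square_pos[of t] by simp
  have "?b \<le> 2 powr (r / 2) * (1 + \<bar>t\<bar> powr r)"
  proof -
    have le: "(1 + t\<^sup>2) powr (r / 2) \<le> (2 * m) powr (r / 2)" if "1 + t\<^sup>2 \<le> 2 * m" for m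
      using assms that one_plus_square_pos[of t] by (intro powr_mono2) auto
    have sq: "(t\<^sup>2) powr (r / 2) = \<bar>t\<bar> powr r"
      using powr_powr[of "\<bar>t\<bar>" 2 "r / 2"] by simp
    have "?b \<le> 2 powr (r / 2) * 1 \<or> ?b \<le> 2 powr (r / 2) * \<bar>t\<bar> powr r"
      using le[of 1] le[of "t\<^sup>2"] by (cases "t\<^sup>2 \<le> 1") (auto simp: powr_mult sq)
    then show ?thesis by (auto simp: distrib_left intro: order_trans)
  qed
  moreover have "g powr q \<le> ?a + ?b"
  proof (cases "g = 0")
    case False
    then have g: "g > 0" using assms by simp
    have a: "?a > 0" using g one_plus_square_pos[of t] by simp
    have e: "(s - 1) / 2 * (q / 2) + r / 2 * (1 - q / 2) = 0"
      using rel by (simp add: field_simps)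
    have "?a powr (q / 2) * ?b powr (1 - q / 2)
       = (g\<^sup>2) powr (q / 2) * ((1 + t\<^sup>2) powr ((s - 1) / 2 * (q / 2)) * (1 + t\<^sup>2) powr (r / 2 * (1 - q / 2)))"
      using g one_plus_square_pos[of t] by (simp add: powr_mult powr_powr)
    also have "\<dots> = (g\<^sup>2) powr (q / 2)"
      unfolding powr_add[symmetric] e using one_plus_square_pos[of t] by simp
    also have "\<dots> = g powr q" using powr_powr[of g 2 "q / 2"] g by simp
    finally have "g powr q = ?a powr (q / 2) * ?b powr (1 - q / 2)" by simp
    also have "\<dots> \<le> q / 2 * ?a + (1 - q / 2) * ?b"
      using a b assms by (intro Youngs_inequality_0) auto
    also have "\<dots> \<le> 1 * ?a + 1 * ?b"
      using a b assms by (intro add_mono mult_right_mono) auto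
    finally show ?thesis by simp
  qed (use b in auto)
  ultimately show ?thesis by linarith
qed

text \<open>The a priori bound, for data normalised by \<open>\<parallel>h\<parallel>\<^sub>p \<le> 1\<close>; by linearity this gives the bound by a multiple
  of \<open>\<parallel>h\<parallel>\<^sub>p\<close> in general. In the proof \<open>E\<close> is the weighted energy, \<open>Y\<close> the integral controlled by the
  Sobolev inequality and \<open>R\<close> the integral of \<open>|u|\<^sup>r\<close>. The bounds run in a circle,
  \<open>R \<lesssim> 1 + Y\<close>, \<open>Y \<lesssim> E\<^bsup>\<sigma>/2\<^esup>\<close> and \<open>E \<lesssim> (1 + R)\<^bsup>1/p'\<^esup>\<close>, which closes because \<open>(\<sigma>/2)(1/p') < 1\<close>.\<close>

lemma gradient_estimate:
  fixes c :: "('n::finite, 'm::finite) vfields"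
  assumes fin: "finite_measure (lebesgue_on \<Omega>)" and Q: "Q > 2"
    and sob: "sobolev_inequality c \<Omega> Q" and A: "admissible_matrix \<Omega> A \<alpha> \<beta>"
    and p: "1 < p" "p < 2 * Q / (Q + 2)"
  shows "\<exists>C\<ge>0. \<forall>u G h. W0_grad c \<Omega> 2 u G \<longrightarrow>
     (\<forall>v H. W0_grad c \<Omega> 2 v H \<longrightarrow>
        (LINT x|lebesgue_on \<Omega>. (A x *v G x) \<bullet> H x) = (LINT x|lebesgue_on \<Omega>. h x * v x)) \<longrightarrow>
     in_Lp \<Omega> p h \<longrightarrow> (LINT x|lebesgue_on \<Omega>. \<bar>h x\<bar> powr p) \<le> 1 \<longrightarrow>
     (LINT x|lebesgue_on \<Omega>. \<bar>u x\<bar> powr sobolev_exponent Q p) \<le> C \<and>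
     (LINT x|lebesgue_on \<Omega>. norm (G x) powr sobolev_exponent Q p) \<le> C"
proof -
  interpret finite_measure "lebesgue_on \<Omega>" by fact
  let ?M = "lebesgue_on \<Omega>"
  define s where "s = Q * (p - 1) / (Q - 2 * p)"
  define r where "r = p * Q / (Q - 2 * p)"
  define q where "q = sobolev_exponent Q p"
  define \<sigma> where "\<sigma> = sobolev_exponent Q 2"
  note rel = exponent_relations[OF Q p, folded s_def r_def q_def \<sigma>_def]
  define b where "b = (s - 1) / 2"
  define d where "d = (s - 1) / 4"
  have b: "- 1 / 2 \<le> b" "b \<le> 0" "1 + 2 * b = s" using rel by (auto simp: b_def field_simps)
  have d: "- 1 / 2 \<le> d" "d \<le> 0" "1 + 2 * d = (1 + s) / 2" using rel by (auto simp: d_def field_simps)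
  have \<alpha>: "0 < \<alpha>" using A by (simp add: admissible_matrix_def)
  have p': "0 < p / (p - 1)" using p by simp
  obtain S where "\<And>u G. W0_grad c \<Omega> 2 u G \<Longrightarrow> in_Lp \<Omega> \<sigma> u \<and> Lp_norm \<Omega> \<sigma> u \<le> S * Lp_norm \<Omega> 2 G"
    using sob Q unfolding sobolev_inequality_def \<sigma>_def by (metis one_le_numeral)
  then have S: "in_Lp \<Omega> \<sigma> u" "Lp_norm \<Omega> \<sigma> u \<le> S * Lp_norm \<Omega> 2 G" if "W0_grad c \<Omega> 2 u G" for u G
    using that by auto
  define m where "m = measure ?M (space ?M)"
  have m: "0 \<le> m" by (simp add: m_def)
  \<comment> \<open>the constants of the successive bounds for \<open>1 + \<integral> |u|\<^sup>r\<close>, for the energy and for the two integrals\<close>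
  define K where "K = 1 + m + 2 powr (- d * \<sigma>) * \<bar>S\<bar> powr \<sigma>"
  define C where "C = 2 * K powr ((p - 1) / p) / (s * \<alpha>)"
  define E0 where "E0 = max 1 ((C * 2 powr ((p - 1) / p)) powr (1 / (1 - \<sigma> / 2 * ((p - 1) / p))))"
  define R0 where "R0 = K * (1 + E0 powr (\<sigma> / 2))"
  define C1 where "C1 = m + R0 + E0 + 2 powr (r / 2) * (m + R0)"
  have K: "1 \<le> K" using m by (simp add: K_def)
  have C: "0 \<le> C" using rel \<alpha> by (simp add: C_def)
  have "1 \<le> E0" by (simp add: E0_def)
  have R0: "0 \<le> R0" using K by (simp add: R0_def)
  have "0 \<le> C1" using m R0 \<open>1 \<le> E0\<close> by (simp add: C1_def)
  moreover have "(LINT x|?M. \<bar>u x\<bar> powr q) \<le> C1 \<and> (LINT x|?M. norm (G x) powr q) \<le> C1"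
    if W: "W0_grad c \<Omega> 2 u G" and eq: "\<And>v H. W0_grad c \<Omega> 2 v H \<Longrightarrow>
        (LINT x|?M. (A x *v G x) \<bullet> H x) = (LINT x|?M. h x * v x)"
      and h: "in_Lp \<Omega> p h" "(LINT x|?M. \<bar>h x\<bar> powr p) \<le> 1" for u G h
  proof -
    define E where "E = (LINT x|?M. (norm (G x))\<^sup>2 * (1 + (u x)\<^sup>2) powr b)"
    define Y where "Y = (LINT x|?M. \<bar>damp d (u x)\<bar> powr \<sigma>)"
    define R where "R = (LINT x|?M. \<bar>u x\<bar> powr r)"
    have E: "0 \<le> E" and Y: "0 \<le> Y" and R: "0 \<le> R" by (auto simp: E_def Y_def R_def)
    have in2: "in_Lp \<Omega> 2 u" "in_Lp \<Omega> 2 G" using W0_grad_in_Lp[OF W] by auto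
    then have [measurable]: "u \<in> borel_measurable ?M" "G \<in> borel_measurable ?M" by (auto simp: in_Lp_def)
    have [measurable]: "damp b \<in> borel_measurable borel"
      by (rule borel_measurable_continuous_onI)
        (use DERIV_damp DERIV_isCont continuous_at_imp_continuous_on in blast)
    have G2: "integrable ?M (\<lambda>x. (norm (G x))\<^sup>2)" using in2 by (simp add: in_Lp_def)
    have w: "0 \<le> (1 + t\<^sup>2) powr b" "(1 + t\<^sup>2) powr b \<le> 1" for t
      using damp_deriv_bounds(4)[OF b(1,2)] by auto
    have iE: "integrable ?M (\<lambda>x. (norm (G x))\<^sup>2 * (1 + (u x)\<^sup>2) powr b)"
    proof (rule Bochner_Integration.integrable_bound[OF G2])
      show "AE x in ?M. norm ((norm (G x))\<^sup>2 * (1 + (u x)\<^sup>2) powr b) \<le> norm ((norm (G x))\<^sup>2)"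
        using w(2) by (intro AE_I2) (simp add: mult_left_le)
    qed measurable
    \<comment> \<open>Sobolev inequality for the smooth version of \<open>|u|\<^bsup>(1 + s)/2\<^esup>\<close>\<close>
    have Wd: "W0_grad c \<Omega> 2 (\<lambda>x. damp d (u x)) (\<lambda>x. damp_deriv d (u x) *\<^sub>R G x)"
      by (rule W0_grad_damp[OF fin _ W d(1,2)]) simp
    have "(LINT x|?M. norm (damp_deriv d (u x) *\<^sub>R G x) powr 2) \<le> E"
      unfolding E_def
    proof (rule integral_mono[OF _ iE])
      show "integrable ?M (\<lambda>x. norm (damp_deriv d (u x) *\<^sub>R G x) powr 2)"
        using W0_grad_in_Lp[OF Wd] by (simp add: in_Lp_def)
      fix x
      have "(damp_deriv d (u x))\<^sup>2 \<le> ((1 + (u x)\<^sup>2) powr d)\<^sup>2"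
        using damp_deriv_bounds[OF d(1,2)] by (intro power_mono) auto
      also have "\<dots> = (1 + (u x)\<^sup>2) powr b"
        by (simp add: power2_eq_square b_def d_def flip: powr_add)
      finally have "(norm (G x))\<^sup>2 * (damp_deriv d (u x))\<^sup>2 \<le> (norm (G x))\<^sup>2 * (1 + (u x)\<^sup>2) powr b"
        by (intro mult_left_mono) auto
      then show "norm (damp_deriv d (u x) *\<^sub>R G x) powr 2 \<le> (norm (G x))\<^sup>2 * (1 + (u x)\<^sup>2) powr b"
        by (simp add: power_mult_distrib mult.commute)
    qed
    then have "Lp_norm \<Omega> 2 (\<lambda>x. damp_deriv d (u x) *\<^sub>R G x) \<le> E powr (1 / 2)"
      unfolding Lp_norm_def by (intro powr_mono2) auto
    then have "S * Lp_norm \<Omega> 2 (\<lambda>x. damp_deriv d (u x) *\<^sub>R G x) \<le> \<bar>S\<bar> * E powr (1 / 2)"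
      by (intro mult_mono) (auto simp: Lp_norm_def)
    then have "Y powr (1 / \<sigma>) \<le> \<bar>S\<bar> * E powr (1 / 2)"
      using S(2)[OF Wd] by (simp add: Lp_norm_def Y_def)
    then have "(Y powr (1 / \<sigma>)) powr \<sigma> \<le> (\<bar>S\<bar> * E powr (1 / 2)) powr \<sigma>"
      using rel by (intro powr_mono2) auto
    then have YE: "Y \<le> \<bar>S\<bar> powr \<sigma> * E powr (\<sigma> / 2)"
      using rel Y by (simp add: powr_powr powr_mult)
    have iY: "integrable ?M (\<lambda>x. \<bar>damp d (u x)\<bar> powr \<sigma>)"
      using S(1)[OF Wd] by (simp add: in_Lp_def)
    have uY: "\<bar>u x\<bar> powr r \<le> 1 + 2 powr (- d * \<sigma>) * \<bar>damp d (u x)\<bar> powr \<sigma>" for x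
      using powr_le_damp[OF d(1,2), of \<sigma> "u x"] rel d(3) by simp
    have iY1: "integrable ?M (\<lambda>x. 1 + 2 powr (- d * \<sigma>) * \<bar>damp d (u x)\<bar> powr \<sigma>)"
      using iY by simp
    have iR: "integrable ?M (\<lambda>x. \<bar>u x\<bar> powr r)"
      by (rule Bochner_Integration.integrable_bound[OF iY1])
        (measurable, intro AE_I2, use uY in \<open>simp add: abs_of_nonneg add_nonneg_nonneg\<close>)
    have "R \<le> (LINT x|?M. 1 + 2 powr (- d * \<sigma>) * \<bar>damp d (u x)\<bar> powr \<sigma>)"
      unfolding R_def using iR iY1 uY by (rule integral_mono)
    also have "\<dots> = m + 2 powr (- d * \<sigma>) * Y" using iY by (simp add: m_def Y_def)
    also have "\<dots> \<le> m + 2 powr (- d * \<sigma>) * (\<bar>S\<bar> powr \<sigma> * E powr (\<sigma> / 2))"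
      using YE by (intro add_left_mono mult_left_mono) auto
    finally have "1 + R \<le> (1 + m) * 1 + (2 powr (- d * \<sigma>) * \<bar>S\<bar> powr \<sigma>) * E powr (\<sigma> / 2)" by simp
    also have "\<dots> \<le> K * 1 + K * E powr (\<sigma> / 2)"
      using m by (intro add_mono mult_right_mono) (auto simp: K_def)
    finally have RE: "1 + R \<le> K * (1 + E powr (\<sigma> / 2))" by (simp add: distrib_left)
    \<comment> \<open>the equation tested with the smooth version of \<open>|u|\<^sup>s sgn u\<close>\<close>
    have Wb: "W0_grad c \<Omega> 2 (\<lambda>x. damp b (u x)) (\<lambda>x. damp_deriv b (u x) *\<^sub>R G x)"
      by (rule W0_grad_damp[OF fin _ W b(1,2)]) simp
    have "s * \<alpha> * E = (LINT x|?M. s * \<alpha> * ((norm (G x))\<^sup>2 * (1 + (u x)\<^sup>2) powr b))"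
      by (simp add: E_def)
    also have "\<dots> \<le> (LINT x|?M. (A x *v G x) \<bullet> (damp_deriv b (u x) *\<^sub>R G x))"
    proof (rule integral_mono)
      show "integrable ?M (\<lambda>x. s * \<alpha> * ((norm (G x))\<^sup>2 * (1 + (u x)\<^sup>2) powr b))" using iE by simp
      show "integrable ?M (\<lambda>x. (A x *v G x) \<bullet> (damp_deriv b (u x) *\<^sub>R G x))"
        using integrable_matrix_form[OF A in2(2)] W0_grad_in_Lp[OF Wb] by blast
      fix x assume "x \<in> space ?M"
      then have "\<alpha> * (norm (G x))\<^sup>2 \<le> (A x *v G x) \<bullet> G x"
        using A by (auto simp: admissible_matrix_def)
      then have "(s * (1 + (u x)\<^sup>2) powr b) * (\<alpha> * (norm (G x))\<^sup>2) \<le> damp_deriv b (u x) * ((A x *v G x) \<bullet> G x)"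
        using damp_deriv_bounds[OF b(1,2), of "u x"] b(3) \<alpha> by (intro mult_mono) auto
      then show "s * \<alpha> * ((norm (G x))\<^sup>2 * (1 + (u x)\<^sup>2) powr b) \<le> (A x *v G x) \<bullet> (damp_deriv b (u x) *\<^sub>R G x)"
        by (simp add: mult_ac)
    qed
    also have "\<dots> = (LINT x|?M. h x * damp b (u x))" by (rule eq[OF Wb])
    also have "\<dots> \<le> 2 * (1 + R) powr ((p - 1) / p)"
    proof (rule integral_mult_le_Holder[OF p(1) h])
      have le: "\<bar>damp b (u x)\<bar> powr (p / (p - 1)) \<le> \<bar>u x\<bar> powr r" for x
      proof -
        have "\<bar>damp b (u x)\<bar> powr (p / (p - 1)) \<le> (\<bar>u x\<bar> powr s) powr (p / (p - 1))"
          using abs_damp_le[OF b(2), of "u x"] b(3) p' by (intro powr_mono2) auto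
        then show ?thesis using rel(3) by (simp only: powr_powr)
      qed
      have i: "integrable ?M (\<lambda>x. \<bar>damp b (u x)\<bar> powr (p / (p - 1)))"
        by (rule Bochner_Integration.integrable_bound[OF iR]) (use le in auto)
      then show "in_Lp \<Omega> (p / (p - 1)) (\<lambda>x. damp b (u x))" by (simp add: in_Lp_def)
      have "(LINT x|?M. \<bar>damp b (u x)\<bar> powr (p / (p - 1))) \<le> R"
        unfolding R_def using i iR le by (rule integral_mono)
      then show "(LINT x|?M. \<bar>damp b (u x)\<bar> powr (p / (p - 1))) \<le> 1 + R" by simp
      show "0 < 1 + R" using R by simp
    qed
    also have "\<dots> \<le> 2 * (K * (1 + E powr (\<sigma> / 2))) powr ((p - 1) / p)"
      using RE R p by (intro mult_left_mono powr_mono2) auto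
    also have "\<dots> = s * \<alpha> * (C * (1 + E powr (\<sigma> / 2)) powr ((p - 1) / p))"
      using rel \<alpha> by (simp add: C_def powr_mult)
    finally have "E \<le> C * (1 + E powr (\<sigma> / 2)) powr ((p - 1) / p)"
      using rel(1) \<alpha> by (simp add: mult_le_cancel_left_pos)
    then have EE0: "E \<le> E0"
      unfolding E0_def using rel C p by (intro absorb_sublinear_power) auto
    have "K * (1 + E powr (\<sigma> / 2)) \<le> R0"
      unfolding R0_def using K E EE0 rel by (intro mult_left_mono add_left_mono powr_mono2) auto
    then have RR0: "R \<le> R0" using RE by linarith
    have "(LINT x|?M. \<bar>u x\<bar> powr q) \<le> m + R"
    proof -
      have le: "\<bar>u x\<bar> powr q \<le> 1 + \<bar>u x\<bar> powr r" for x
        using powr_le_split[of q r 1 "\<bar>u x\<bar>"] rel by simp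
      have i1: "integrable ?M (\<lambda>x. 1 + \<bar>u x\<bar> powr r)" using iR by simp
      have "integrable ?M (\<lambda>x. \<bar>u x\<bar> powr q)"
        by (rule Bochner_Integration.integrable_bound[OF i1]) (use le in auto)
      then have "(LINT x|?M. \<bar>u x\<bar> powr q) \<le> (LINT x|?M. 1 + \<bar>u x\<bar> powr r)"
        using i1 le by (rule integral_mono)
      then show ?thesis using iR by (simp add: m_def R_def)
    qed
    moreover have "(LINT x|?M. norm (G x) powr q) \<le> E + 2 powr (r / 2) * (m + R)"
    proof -
      have "0 < r" using rel by linarith
      then have le: "norm (G x) powr q \<le> (norm (G x))\<^sup>2 * (1 + (u x)\<^sup>2) powr b + 2 powr (r / 2) * (1 + \<bar>u x\<bar> powr r)" for x
        unfolding b_def using rel by (intro powr_le_weighted_square) auto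
      have i1: "integrable ?M (\<lambda>x. (norm (G x))\<^sup>2 * (1 + (u x)\<^sup>2) powr b + 2 powr (r / 2) * (1 + \<bar>u x\<bar> powr r))"
        using iR iE by simp
      have "integrable ?M (\<lambda>x. norm (G x) powr q)"
        using in_Lp_lower_exponent[OF fin in2(2), of q] rel by (simp add: in_Lp_def)
      then have "(LINT x|?M. norm (G x) powr q)
        \<le> (LINT x|?M. (norm (G x))\<^sup>2 * (1 + (u x)\<^sup>2) powr b + 2 powr (r / 2) * (1 + \<bar>u x\<bar> powr r))"
        using i1 le by (rule integral_mono)
      then show ?thesis using iR iE by (simp add: m_def R_def E_def)
    qed
    moreover have "2 powr (r / 2) * (m + R) \<le> 2 powr (r / 2) * (m + R0)"
      using RR0 by (intro mult_left_mono) auto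
    moreover have "0 \<le> 2 powr (r / 2) * (m + R0)" using m R0 by simp
    ultimately show ?thesis
      using RR0 EE0 m R0 E \<open>1 \<le> E0\<close> unfolding C1_def by linarith
  qed
  ultimately show ?thesis unfolding q_def by blast
qed

section \<open>Convergence of the approximations\<close>

lemma Lp_converges_Cauchy:
  assumes "p > 0" "Lp_converges \<Omega> p fs f" "e > 0"
  shows "\<exists>N. \<forall>m\<ge>N. \<forall>n\<ge>N. (LINT x|lebesgue_on \<Omega>. norm (fs m x - fs n x) powr p) < e"
proof -
  let ?J = "\<lambda>n. LINT x|lebesgue_on \<Omega>. norm (fs n x - f x) powr p"
  have in_Lp: "in_Lp \<Omega> p (fs n)" "in_Lp \<Omega> p f" for n
    using assms(2) by (auto simp: Lp_converges_def)
  have "?J \<longlonglongrightarrow> 0" using assms by (simp add: Lp_converges_iff)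
  then have "\<forall>\<^sub>F n in sequentially. ?J n < e / (2 * 2 powr p)"
    using assms(3) by (intro order_tendstoD(2)) auto
  then obtain N where N: "\<And>n. n \<ge> N \<Longrightarrow> ?J n < e / (2 * 2 powr p)"
    by (auto simp: eventually_sequentially)
  have "(LINT x|lebesgue_on \<Omega>. norm (fs m x - fs n x) powr p) < e" if "m \<ge> N" "n \<ge> N" for m n
  proof -
    have "(LINT x|lebesgue_on \<Omega>. norm (fs m x - fs n x) powr p) \<le> 2 powr p * (?J m + ?J n)"
      using integral_norm_diff_powr_le[OF in_Lp(1) in_Lp(2) in_Lp(1) assms(1), of m n]
      by (simp add: norm_minus_commute)
    also have "\<dots> < 2 powr p * (e / (2 * 2 powr p) + e / (2 * 2 powr p))"
      using N that by (intro mult_strict_left_mono add_strict_mono) auto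
    finally show ?thesis by simp
  qed
  then show ?thesis by blast
qed

lemma truncation_measurable:
  "f \<in> borel_measurable M \<Longrightarrow> truncation f n \<in> borel_measurable M"
  unfolding truncation_def[abs_def]
  by (intro borel_measurable_max borel_measurable_min borel_measurable_const)

lemma truncation_converges:
  assumes "p > 0" "in_Lp \<Omega> p f"
  shows "Lp_converges \<Omega> p (truncation f) f"
proof -
  let ?M = "lebesgue_on \<Omega>"
  have [measurable]: "f \<in> borel_measurable ?M" using assms by (simp add: in_Lp_def)
  have [measurable]: "truncation f n \<in> borel_measurable ?M" for n by (rule truncation_measurable) measurable
  have "in_Lp \<Omega> p (truncation f n)" for n
    by (rule in_LpI_bound[OF assms(2) _ assms(1), where K = 1]) (measurable, auto simp: truncation_def)
  moreover have "(\<lambda>n. LINT x|?M. norm (truncation f n x - f x) powr p) \<longlonglongrightarrow> (LINT x|?M. 0)"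
  proof (rule integral_dominated_convergence[where w = "\<lambda>x. norm (f x) powr p"])
    show "AE x in ?M. (\<lambda>n. norm (truncation f n x - f x) powr p) \<longlonglongrightarrow> 0"
    proof (rule AE_I2, rule tendsto_eventually)
      fix x
      obtain N :: nat where N: "\<bar>f x\<bar> \<le> real N" using real_arch_simple by blast
      show "\<forall>\<^sub>F n in sequentially. norm (truncation f n x - f x) powr p = 0"
      proof (rule eventually_sequentiallyI[of N])
        fix n assume "N \<le> n"
        then have "\<bar>f x\<bar> \<le> real n" using N by linarith
        then show "norm (truncation f n x - f x) powr p = 0" by (auto simp: truncation_def min_def max_def abs_le_iff)
      qed
    qed
    show "AE x in ?M. norm (norm (truncation f n x - f x) powr p) \<le> norm (f x) powr p" for n
      using assms(1) by (intro AE_I2) (auto intro!: powr_mono2 simp: truncation_def)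
    show "integrable ?M (\<lambda>x. norm (f x) powr p)" using assms(2) by (simp add: in_Lp_def)
  qed measurable
  ultimately show ?thesis using assms by (simp add: Lp_converges_iff)
qed

lemma integrable_truncation_mult:
  assumes "finite_measure (lebesgue_on \<Omega>)" "f \<in> borel_measurable (lebesgue_on \<Omega>)" "in_Lp \<Omega> 2 v"
  shows "integrable (lebesgue_on \<Omega>) (\<lambda>x. truncation f n x * v x)"
proof -
  have [measurable]: "truncation f n \<in> borel_measurable (lebesgue_on \<Omega>)" "v \<in> borel_measurable (lebesgue_on \<Omega>)"
    using truncation_measurable[OF assms(2)] assms(3) by (auto simp: in_Lp_def)
  have int: "integrable (lebesgue_on \<Omega>) (\<lambda>x. real n * norm (v x))"
    using in_Lp_lower_exponent[OF assms(1,3), of 1] by (simp add: in_Lp_def)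
  show ?thesis
  proof (rule Bochner_Integration.integrable_bound[OF int])
    have "\<bar>truncation f n x * v x\<bar> \<le> real n * \<bar>v x\<bar>" for x
      unfolding abs_mult by (intro mult_right_mono) (auto simp: truncation_def)
    then show "AE x in lebesgue_on \<Omega>. norm (truncation f n x * v x) \<le> norm (real n * norm (v x))"
      by (simp add: abs_mult)
  qed measurable
qed

theorem theorem4p7:
  fixes \<Omega> :: "(real ^ 'n::finite) set"
    and c :: "real ^ 'n \<Rightarrow> real ^ 'n ^ 'm::finite"
    and A :: "real ^ 'n \<Rightarrow> real ^ 'm ^ 'm"
    and f u :: "real ^ 'n \<Rightarrow> real"
    and Q p \<alpha> \<beta> :: real
  assumes "CARD('n) \<ge> 2"
    and "open \<Omega>" and "bounded \<Omega>"
    and "locally_Lipschitz_fields c"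
    and "subunit_connected c \<Omega>"
    and "cc_dist_continuous c \<Omega>"
    and "Q > 2" and "cc_doubling c \<Omega> Q"
    and "cc_poincare c \<Omega>"
    and "sobolev_inequality c \<Omega> Q"
    and "admissible_matrix \<Omega> A \<alpha> \<beta>"
    and "1 < p" and "p < 2 * Q / (Q + 2)"
    and "in_Lp \<Omega> p f"
    and "solution_by_approximation c \<Omega> Q A f u"
  shows "u \<in> W0 c \<Omega> (sobolev_exponent Q p)"
proof -
  let ?M = "lebesgue_on \<Omega>"
  define q where "q = sobolev_exponent Q p"
  have q: "1 < q" "q < 2"
    using exponent_relations(7,8)[OF assms(7,12,13)] by (auto simp: q_def)
  have p0: "0 < p" using assms(12) by simp
  have fin: "finite_measure ?M" by (rule finite_measure_lebesgue_on_bounded_open[OF assms(2,3)])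
  have f_meas: "f \<in> borel_measurable ?M" using assms(14) by (simp add: in_Lp_def)
  obtain us \<tau> where us: "\<And>n. weak_solution c \<Omega> Q A (truncation f n) (us n)"
    and \<tau>: "strict_mono \<tau>"
    and lim: "\<And>s. 1 \<le> s \<Longrightarrow> s < Q / (Q - 2) \<Longrightarrow> Lp_converges \<Omega> s (us \<circ> \<tau>) u"
    using assms(15) unfolding solution_by_approximation_def by blast
  have "\<forall>n. \<exists>G. W0_grad c \<Omega> 2 (us n) G \<and> (\<forall>v H. W0_grad c \<Omega> 2 v H \<longrightarrow>
      (LINT x|?M. (A x *v G x) \<bullet> H x) = (LINT x|?M. truncation f n x * v x))"
    using us unfolding weak_solution_def by blast
  from choice[OF this] obtain G where G: "\<And>n. W0_grad c \<Omega> 2 (us n) (G n)"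
    and eq: "\<And>n v H. W0_grad c \<Omega> 2 v H \<Longrightarrow>
      (LINT x|?M. (A x *v G n x) \<bullet> H x) = (LINT x|?M. truncation f n x * v x)"
    by blast
  obtain C where C: "C \<ge> 0"
    and estimate: "\<And>u G h. W0_grad c \<Omega> 2 u G \<Longrightarrow>
     (\<And>v H. W0_grad c \<Omega> 2 v H \<Longrightarrow> (LINT x|?M. (A x *v G x) \<bullet> H x) = (LINT x|?M. h x * v x)) \<Longrightarrow>
     in_Lp \<Omega> p h \<Longrightarrow> (LINT x|?M. \<bar>h x\<bar> powr p) \<le> 1 \<Longrightarrow>
     (LINT x|?M. \<bar>u x\<bar> powr q) \<le> C \<and> (LINT x|?M. norm (G x) powr q) \<le> C"
    using gradient_estimate[OF fin assms(7,10,11,12,13)] unfolding q_def by blast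
  have conv_f: "Lp_converges \<Omega> p (truncation f) f"
    by (rule truncation_converges[OF p0 assms(14)])
  then have in_tr: "in_Lp \<Omega> p (truncation f n)" for n by (simp add: Lp_converges_def)
  have in2: "in_Lp \<Omega> 2 (G n)" for n using W0_grad_in_Lp[OF G] by blast
  have Cauchy: "\<exists>N. \<forall>m\<ge>N. \<forall>n\<ge>N. (LINT x|?M. norm (us m x - us n x) powr q) < e \<and>
      (LINT x|?M. norm (G m x - G n x) powr q) < e" if e: "e > 0" for e
  proof -
    \<comment> \<open>\<open>us m - us n\<close> is divided by \<open>\<epsilon>\<close> to normalise its datum, and \<open>\<epsilon>\<close> is such that \<open>C \<epsilon>\<^sup>q < e\<close>\<close>
    define \<epsilon> where "\<epsilon> = (e / (C + 1)) powr (1 / q)"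
    have \<epsilon>: "\<epsilon> > 0" using e C by (simp add: \<epsilon>_def)
    have "C * \<epsilon> powr q = e * (C / (C + 1))" using e C q by (simp add: \<epsilon>_def powr_powr)
    also have "\<dots> < e * 1" using e C by (intro mult_strict_left_mono) auto
    finally have C\<epsilon>: "C * \<epsilon> powr q < e" by simp
    obtain N where N: "\<And>m n. m \<ge> N \<Longrightarrow> n \<ge> N \<Longrightarrow>
        (LINT x|?M. norm (truncation f m x - truncation f n x) powr p) < \<epsilon> powr p"
      using Lp_converges_Cauchy[OF p0 conv_f, of "\<epsilon> powr p"] \<epsilon> by auto
    have "(LINT x|?M. norm (us m x - us n x) powr q) < e \<and> (LINT x|?M. norm (G m x - G n x) powr q) < e"
      if mn: "m \<ge> N" "n \<ge> N" for m n
    proof -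
      let ?a = "1 / \<epsilon>"
      have scale: "(LINT x|?M. norm (?a *\<^sub>R g x) powr t) = (LINT x|?M. norm (g x) powr t) / \<epsilon> powr t"
        for g :: "real ^ 'n \<Rightarrow> 'z::euclidean_space" and t
        using \<epsilon> by (simp add: powr_divide)
      have h: "in_Lp \<Omega> p (\<lambda>x. ?a *\<^sub>R (truncation f m x - truncation f n x))"
        by (intro in_Lp_scaleR in_Lp_diff in_tr p0)
      have h1: "(LINT x|?M. \<bar>?a *\<^sub>R (truncation f m x - truncation f n x)\<bar> powr p) \<le> 1"
        using scale[of "\<lambda>x. truncation f m x - truncation f n x" p] N[OF mn] \<epsilon> by simp
      have W: "W0_grad c \<Omega> 2 (\<lambda>x. ?a * (us m x - us n x)) (\<lambda>x. ?a *\<^sub>R (G m x - G n x))"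
        by (rule W0_grad_scaled_diff[OF G G]) simp
      have "(LINT x|?M. (A x *v (?a *\<^sub>R (G m x - G n x))) \<bullet> H x)
         = (LINT x|?M. (?a *\<^sub>R (truncation f m x - truncation f n x)) * v x)"
        if vH: "W0_grad c \<Omega> 2 v H" for v H
      proof -
        have i: "integrable ?M (\<lambda>x. (A x *v G k x) \<bullet> H x)" "integrable ?M (\<lambda>x. truncation f k x * v x)" for k
          using integrable_matrix_form[OF assms(11) in2, of H] integrable_truncation_mult[OF fin f_meas, of v]
            W0_grad_in_Lp[OF vH] by auto
        have "(LINT x|?M. (A x *v (?a *\<^sub>R (G m x - G n x))) \<bullet> H x)
           = (LINT x|?M. ?a * ((A x *v G m x) \<bullet> H x - (A x *v G n x) \<bullet> H x))"
          by (simp only: matrix_vector_mult_scaleR matrix_vector_mult_diff_distrib inner_diff_left inner_scaleR_left)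
        also have "\<dots> = ?a * ((LINT x|?M. truncation f m x * v x) - (LINT x|?M. truncation f n x * v x))"
          using i by (simp add: eq[OF vH])
        also have "\<dots> = (LINT x|?M. ?a * (truncation f m x * v x - truncation f n x * v x))"
          using i by simp
        finally show ?thesis by (simp add: algebra_simps)
      qed
      from estimate[OF W this h h1] scale[of "\<lambda>x. us m x - us n x" q] scale[of "\<lambda>x. G m x - G n x" q]
      have "(LINT x|?M. norm (us m x - us n x) powr q) / \<epsilon> powr q \<le> C"
        "(LINT x|?M. norm (G m x - G n x) powr q) / \<epsilon> powr q \<le> C" by simp_all
      then show ?thesis using C\<epsilon> \<epsilon> by (simp add: divide_le_eq)
    qed
    then show ?thesis by blast
  qed
  have W: "W0_grad c \<Omega> q (us n) (G n)" for n
    by (rule W0_grad_lower_exponent[OF fin G]) (use q in auto)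
  have in_q: "in_Lp \<Omega> q (us n)" "in_Lp \<Omega> q (G n)" for n using W0_grad_in_Lp[OF W] by auto
  \<comment> \<open>the limit of the gradients exists by completeness, that of the functions is already known to be \<open>u\<close>\<close>
  obtain G0 where G0: "Lp_converges \<Omega> q G G0"
    using Lp_complete[OF fin _ in_q(2)] q Cauchy by (meson less_imp_le)
  have "Lp_converges \<Omega> 1 (us \<circ> \<tau>) u" using lim[of 1] assms(7) by (simp add: less_divide_eq)
  then obtain r where r: "strict_mono r" "AE x in ?M. (\<lambda>n. us (\<tau> (r n)) x) \<longlonglongrightarrow> u x"
    and u: "u \<in> borel_measurable ?M"
    using Lp_converges_AE_subseq[OF fin, of 1 "us \<circ> \<tau>" u] by (auto simp: Lp_converges_def in_Lp_def)
  have "Lp_converges \<Omega> q us u"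
  proof (rule Lp_Cauchy_AE_limit[OF _ in_q(1) u])
    show "strict_mono (\<tau> \<circ> r)" using \<tau> r(1) by (rule strict_mono_o)
    show "AE x in ?M. (\<lambda>n. us ((\<tau> \<circ> r) n) x) \<longlonglongrightarrow> u x" using r(2) by simp
  qed (use q Cauchy in \<open>simp, meson\<close>)
  then have "W0_grad c \<Omega> q u G0"
    using W0_grad_closed[OF _ W _ G0] q by simp
  then show ?thesis unfolding W0_def q_def by blast
qed

end
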